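(* Let $n\ge 2$, $\lambda=(\lambda_1,\dots,\lambda_n)\in\mathbb{R}^n$, $x=(x_1,\dots,x_n)\in\mathbb{R}^n$, $d=n(n-1)/2$, and let $\Psi_\lambda(x)$ be the $GL(n,\mathbb{R})$ Whittaker wave function defined in the context. Write $\mathrm{i}=\sqrt{-1}$. Then $$\Psi_\lambda(x)=\frac{e^{-\mathrm{i}\sum_k\lambda_kx_k}}{(2\pi \mathrm{i})^{d}}\int_C \exp\Big(\sum_{k=1}^n(\gamma_{1,n+2-k}-\gamma_{1,n+1-k})x_k\Big)\prod_{1\le k<l\le n}\Gamma\big(\gamma_{k,l}-\gamma_{k+1,l}+\mathrm{i}(\lambda_k-\lambda_{n+k-l+1})\big)\,\Gamma(\gamma_{k,l}-\gamma_{k+1,l+1})\,d\gamma_{k,l}.$$ Here $\gamma_{k,l}=0$ by convention unless $1\le k<l\le n$, and the integration cycle $C$ is a shift of the imaginary plane $\operatorname{Re}\gamma_{k,l}=0$ into the domain where all Gamma arguments have positive real part: $C=\{\operatorname{Re}\gamma_{k,l}=c_{k,l}\}$, each variable running upwards, where the $c_{k,l}$ $(1\le k<l\le n)$ are any real constants with $c_{k,l}>c_{k+1,l}$ and $c_{k,l}>c_{k+1,l+1}$ (with $c_{k,l}=0$ by convention unless $1\le k<l\le n$).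
   Context: Let $e_{a,b}$ be the $n\times n$ matrix units and $\mathrm{Id}$ the identity matrix. For variables $t=(t_{i,j})_{1\le i<j\le n}$ put $$X(t)=R_{n-1}R_{n-2}\cdots R_1,\qquad R_i=(\mathrm{Id}+t_{i,n}e_{i,i+1})(\mathrm{Id}+t_{i,n-1}e_{i+1,i+2})\cdots(\mathrm{Id}+t_{i,i+1}e_{n-1,n}),$$ so $t_{i,j}$ multiplies $e_{n-j+i,\,n-j+i+1}$. Let $\bar w_0=\sum_{k=1}^n(-1)^{k-1}e_{k,n+1-k}$. For a diagonal matrix $T=\mathrm{diag}(T_1,\dots,T_n)$ with positive entries and $\nu\in\mathbb{C}^n$ put $\chi_\nu(T)=\prod_kT_k^{\nu_k}$. Let $\rho_k=\frac{n+1}{2}-k$, $\rho=(\rho_1,\dots,\rho_n)$, and $(\rho,x)=\sum_k\rho_kx_k$. Right Whittaker vector: for $Y$ lower triangular unipotent, $T$ positive diagonal, and all $t_{i,j}>0$, $v^R_\mu(Y\,T\,X(t))=\chi_\mu(T)\exp(-\sum_{i<j}t_{i,j})$. Left Whittaker vector: for all $t_{i,j}>0$ there is a unique factorization $X(-t)\bar w_0=Y\,T\,X(p)$ with $Y$ lower triangular unipotent, $T$ diagonal (its entries are positive) and all $p_{i,j}>0$; put $v^L_\nu(X(t))=\chi_\nu(T)\exp(-\sum_{i<j}p_{i,j})$. With $\mu=\mathrm{i}\lambda-\rho$ and $h(x)=\sum_kx_ke_{k,k}$, the Whittaker wave function is $$\Psi_\lambda(x)=e^{-(\rho,x)}\int_{t_{i,j}>0}\overline{v^L_{\mu}(X(t))}\;v^R_{\mu}\big(X(t)e^{-h(x)}\big)\prod_{i<j}t_{i,j}^{\,j-i}\frac{dt_{i,j}}{t_{i,j}}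 .$$ *)

theory Defs
  imports
    "HOL-Analysis.Analysis"
    "Jordan_Normal_Form.Matrix"
begin

text \<open>
  All mathematical indices are 1-based, so \<open>x\<^sub>k\<close> is \<open>x k\<close> and only the values at \<open>1 \<le> k \<le> n\<close>
  matter. Matrix entries are 0-based, so the \<open>(a,b)\<close> entry of \<open>A\<close> is \<open>A $$ (a - 1, b - 1)\<close>.
\<close>

definition pairs :: "nat \<Rightarrow> (nat \<times> nat) set" where
  "pairs n = {(i, j). 1 \<le> i \<and> i < j \<and> j \<le> n}"

definition zero_ext :: "nat \<Rightarrow> (nat \<times> nat \<Rightarrow> 'a::zero) \<Rightarrow> nat \<Rightarrow> nat \<Rightarrow> 'a" where
  "zero_ext n g k l = (if (k, l) \<in> pairs n then g (k, l) else 0)"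

text \<open>
  Parameters are extensional outside \<open>pairs n\<close>, as in the space of \<open>PiM (pairs n)\<close>; this makes
  factorizations in terms of them unique.
\<close>

definition pos_params :: "nat \<Rightarrow> (nat \<times> nat \<Rightarrow> real) set" where
  "pos_params n = PiE (pairs n) (\<lambda>_. {0<..})"

definition matrix_unit :: "nat \<Rightarrow> nat \<Rightarrow> nat \<Rightarrow> real mat" where
  "matrix_unit n a b = Matrix.mat n n (\<lambda>(r, s). if Suc r = a \<and> Suc s = b then 1 else 0)"

definition mat_product :: "nat \<Rightarrow> real mat list \<Rightarrow> real mat" where
  "mat_product n As = foldr (*) As (1\<^sub>m n)"

definition Rmat :: "nat \<Rightarrow> (nat \<times> nat \<Rightarrow> real) \<Rightarrow> nat \<Rightarrow> real mat" where
  "Rmat n t i = mat_product n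
     (map (\<lambda>j. 1\<^sub>m n + t (i, j) \<cdot>\<^sub>m matrix_unit n (n - j + i) (n - j + i + 1)) (rev [i + 1..<n + 1]))"

definition Xmat :: "nat \<Rightarrow> (nat \<times> nat \<Rightarrow> real) \<Rightarrow> real mat" where
  "Xmat n t = mat_product n (map (Rmat n t) (rev [1..<n]))"

definition w0bar :: "nat \<Rightarrow> real mat" where
  "w0bar n = Matrix.mat n n (\<lambda>(r, s). \<Sum>k = 1..n. (-1) ^ (k - 1) * matrix_unit n k (n + 1 - k) $$ (r, s))"

definition diag1 :: "nat \<Rightarrow> (nat \<Rightarrow> real) \<Rightarrow> real mat" where
  "diag1 n x = mat_diag n (\<lambda>r. x (Suc r))"

text \<open>The matrix exponential as an entrywise power series.\<close>

definition mat_exp :: "nat \<Rightarrow> real mat \<Rightarrow> real mat" where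
  "mat_exp n A = Matrix.mat n n (\<lambda>(r, s). \<Sum>m. (A ^\<^sub>m m) $$ (r, s) / fact m)"

definition lower_unipotent :: "nat \<Rightarrow> real mat set" where
  "lower_unipotent n = {Y \<in> carrier_mat n n.
     (\<forall>r<n. Y $$ (r, r) = 1) \<and> (\<forall>r<n. \<forall>s<n. r < s \<longrightarrow> Y $$ (r, s) = 0)}"

definition pos_diagonal :: "nat \<Rightarrow> real mat set" where
  "pos_diagonal n = {T \<in> carrier_mat n n. diagonal_mat T \<and> (\<forall>r<n. T $$ (r, r) > 0)}"

definition chi :: "nat \<Rightarrow> (nat \<Rightarrow> complex) \<Rightarrow> real mat \<Rightarrow> complex" where
  "chi n \<nu> T = (\<Prod>k = 1..n. complex_of_real (T $$ (k - 1, k - 1)) powr \<nu> k)"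

definition rho :: "nat \<Rightarrow> nat \<Rightarrow> real" where
  "rho n k = (real n + 1) / 2 - real k"

text \<open>
  The Whittaker vectors are partial functions of a matrix, prescribed through factorizations
  that are unique when they exist; \<open>THE\<close> reads off the prescribed value. In the left vector the
  entries of \<open>T\<close> are automatically positive, so that \<open>pos_diagonal\<close> is no restriction there.
\<close>

definition right_whittaker :: "nat \<Rightarrow> (nat \<Rightarrow> complex) \<Rightarrow> real mat \<Rightarrow> complex" where
  "right_whittaker n \<mu> g = (THE v. \<exists>Y\<in>lower_unipotent n. \<exists>T\<in>pos_diagonal n. \<exists>t\<in>pos_params n.
     g = Y * T * Xmat n t \<and>
     v = chi n \<mu> T * complex_of_real (exp (- (\<Sum>ij\<in>pairs n. t ij))))"

definition left_whittaker :: "nat \<Rightarrow> (nat \<Rightarrow> complex) \<Rightarrow> real mat \<Rightarrow> complex" where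
  "left_whittaker n \<nu> g = (THE v. \<exists>t\<in>pos_params n. g = Xmat n t \<and>
     (\<exists>Y\<in>lower_unipotent n. \<exists>T\<in>pos_diagonal n. \<exists>p\<in>pos_params n.
       Xmat n (\<lambda>ij. - t ij) * w0bar n = Y * T * Xmat n p \<and>
       v = chi n \<nu> T * complex_of_real (exp (- (\<Sum>ij\<in>pairs n. p ij)))))"

definition wave_integrand ::
    "nat \<Rightarrow> (nat \<Rightarrow> real) \<Rightarrow> (nat \<Rightarrow> real) \<Rightarrow> (nat \<times> nat \<Rightarrow> real) \<Rightarrow> complex" where
  "wave_integrand n lam x t =
     (let \<mu> = (\<lambda>k. \<i> * complex_of_real (lam k) - complex_of_real (rho n k)) in
      cnj (left_whittaker n \<mu> (Xmat n t)) *
      right_whittaker n \<mu> (Xmat n t * mat_exp n (- diag1 n x)) *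
      complex_of_real (\<Prod>(i, j)\<in>pairs n. t (i, j) ^ (j - i) / t (i, j)))"

definition wave_function :: "nat \<Rightarrow> (nat \<Rightarrow> real) \<Rightarrow> (nat \<Rightarrow> real) \<Rightarrow> complex" where
  "wave_function n lam x =
     complex_of_real (exp (- (\<Sum>k = 1..n. rho n k * x k))) *
     (CLINT t:pos_params n|PiM (pairs n) (\<lambda>_. lborel). wave_integrand n lam x t)"

definition mellin_barnes_integrand ::
    "nat \<Rightarrow> (nat \<Rightarrow> real) \<Rightarrow> (nat \<Rightarrow> real) \<Rightarrow> (nat \<times> nat \<Rightarrow> complex) \<Rightarrow> complex" where
  "mellin_barnes_integrand n lam x \<gamma>' =
     (let \<gamma> = zero_ext n \<gamma>' in
      exp (\<Sum>k = 1..n. (\<gamma> 1 (n + 2 - k) - \<gamma> 1 (n + 1 - k)) * complex_of_real (x k)) *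
      (\<Prod>(k, l)\<in>pairs n.
         Gamma (\<gamma> k l - \<gamma> (k + 1) l + \<i> * complex_of_real (lam k - lam (n + k - l + 1))) *
         Gamma (\<gamma> k l - \<gamma> (k + 1) (l + 1))))"

text \<open>
  Integrals over \<open>{Re \<gamma>\<^sub>k\<^sub>l = c\<^sub>k\<^sub>l}\<close>, with \<open>\<gamma> = c + \<i>y\<close>: each upward line contributes
  \<open>d\<gamma>\<^sub>k\<^sub>l = \<i> dy\<^sub>k\<^sub>l\<close>, whence the power of \<open>\<i>\<close>.
\<close>

definition on_vertical :: "('i \<Rightarrow> real) \<Rightarrow> ('i \<Rightarrow> real) \<Rightarrow> 'i \<Rightarrow> complex" where
  "on_vertical c y = (\<lambda>i. complex_of_real (c i) + \<i> * complex_of_real (y i))"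

definition vertical_integrable ::
    "'i set \<Rightarrow> ('i \<Rightarrow> real) \<Rightarrow> (('i \<Rightarrow> complex) \<Rightarrow> complex) \<Rightarrow> bool" where
  "vertical_integrable I c f \<longleftrightarrow> integrable (PiM I (\<lambda>_. lborel)) (\<lambda>y. f (on_vertical c y))"

definition vertical_integral ::
    "'i set \<Rightarrow> ('i \<Rightarrow> real) \<Rightarrow> (('i \<Rightarrow> complex) \<Rightarrow> complex) \<Rightarrow> complex" where
  "vertical_integral I c f = \<i> ^ card I * (CLINT y|PiM I (\<lambda>_. lborel). f (on_vertical c y))"

end

theory Submission
  imports Defs "HOL-Probability.Characteristic_Functions" "HOL-Probability.Sinc_Integral"
begin

text \<open>
  The factorization \<open>X(-t) w\<^sub>0 = Y T X(p)\<close> is monomial. Peeling off \<open>R\<^sub>1\<close> and inducting on \<open>n\<close> gives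
  \<open>p(i, j) = u(i, n + 1 + i - j)\<close>, where
  \<open>u(k, l) = (\<Prod>m<k. t(m, l - 1)) / (\<Prod>m\<le>k. t(m, l))\<close>. In logarithmic coordinates the passage from
  \<open>t\<close> to \<open>u\<close> is linear and triangular with diagonal entries \<open>-1\<close>, hence preserves Lebesgue measure,
  and the integrand of the wave function becomes an imaginary power of \<open>t\<close> times
  \<open>\<Prod> exp(-u(k, l))\<close> and \<open>\<Prod> exp(-t(i, j) exp(x\<^sub>m - x\<^sub>m\<^sub>+\<^sub>1))\<close> with \<open>m = n - j + i\<close>.

  Mellin-Barnes inversion \<open>2\<pi> exp(-e\<^sup>v) = \<integral> \<Gamma>(c + iy) exp(-(c + iy) v) dy\<close> is applied to each factor
  of the last product, with Mellin variable \<open>\<gamma>(i, j) - \<gamma>(i + 1, j + 1)\<close>, again a unimodular change of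
  variables; the integral over \<open>t\<close> is then a product of Gamma integrals in \<open>u\<close>. The absolute value of
  the joint integrand is an integrable function of \<open>t\<close> times an integrable function of \<open>\<gamma>\<close>, so Fubini
  applies and also yields both integrability claims.
\<close>

subsection \<open>Changes of variables on finite products of Lebesgue measure\<close>

text \<open>The regrouping rests on one bilinear identity, \<open>sum_gamma_arg1_dual\<close>.
  Pairing the arguments of the first Gamma family with log u gives minus the pairing of the second
  family with log t, minus i times the sum of (lam_i - lam_j) log t(i, j). So the powers of t
  created by the inversion, together with the imaginary power already present, are exactly a product
  of powers of the u(k, l), and the exponents are the arguments of the remaining Gamma functions.
  The obstacle is convergence: the pure imaginary power of t gives no decay at infinity in gamma,
  and the inversion integral is not trivially invertible. The shifted plane settles both. On it all
  exponents have constant positive real part, so the modulus of the powers of u does not see the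
  imaginary parts of gamma, and this is why the majorant splits. Inversion itself needs
  \<open>Gamma\<close> to be integrable on a vertical line, for which two uses of the functional
  equation suffice. Since the Whittaker vectors are definite descriptions, an explicit factorization
  is not enough: \<open>LDU_unique\<close> and \<open>Xmat_inj\<close> make their values well
  defined.\<close>

lemma integrable_pair_bound:
  fixes F :: "'a \<times> 'b \<Rightarrow> 'c::{banach, second_countable_topology}"
  assumes "sigma_finite_measure M" "sigma_finite_measure N"
    and F: "F \<in> borel_measurable (M \<Otimes>\<^sub>M N)"
    and a: "integrable M a" and b: "integrable N b"
    and bound: "\<And>x y. x \<in> space M \<Longrightarrow> y \<in> space N \<Longrightarrow> norm (F (x, y)) \<le> a x * b y"
  shows "integrable (M \<Otimes>\<^sub>M N) F"
proof -
  interpret pair_sigma_finite M N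
    using assms(1,2) by (simp add: pair_sigma_finite_def)
  have int: "integrable (M \<Otimes>\<^sub>M N) (\<lambda>(x, y). a x * b y)"
  proof (rule Fubini_integrable)
    show "(\<lambda>(x, y). a x * b y) \<in> borel_measurable (M \<Otimes>\<^sub>M N)"
      using a b by measurable
    show "integrable M (\<lambda>x. LINT y|N. norm (case (x, y) of (x, y) \<Rightarrow> a x * b y))"
      using a by (simp add: abs_mult)
    show "AE x in M. integrable N (\<lambda>y. case (x, y) of (x, y) \<Rightarrow> a x * b y)"
      using b by simp
  qed
  show ?thesis
    by (rule Bochner_Integration.integrable_bound[OF int F])
       (use bound in \<open>force intro!: AE_I2 simp: space_pair_measure\<close>)
qed

lemma emeasure_distr_density:
  assumes f: "f \<in> borel_measurable M" and T[measurable]: "T \<in> M \<rightarrow>\<^sub>M N" and A[measurable]: "A \<in> sets N"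
  shows "emeasure (distr (density M f) N T) A = (\<integral>\<^sup>+x. f x * indicator A (T x) \<partial>M)"
proof -
  have "emeasure (distr (density M f) N T) A = emeasure (density M f) (T -` A \<inter> space M)"
    by (subst emeasure_distr) auto
  also have "\<dots> = (\<integral>\<^sup>+x. f x * indicator (T -` A \<inter> space M) x \<partial>M)"
    using f by (rule emeasure_density) measurable
  also have "\<dots> = (\<integral>\<^sup>+x. f x * indicator A (T x) \<partial>M)"
    by (auto intro!: nn_integral_cong split: split_indicator)
  finally show ?thesis .
qed

lemma distr_ln_haar:
  "distr (density lborel (\<lambda>t. ennreal (indicator {0<..} t / t))) lborel ln = (lborel :: real measure)"
proof (rule lborel_eqI[symmetric])
  fix l u :: real
  assume lu: "\<And>b. b \<in> Basis \<Longrightarrow> l \<bullet> b \<le> u \<bullet> b"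
  then have lu: "l \<le> u" by simp
  have "emeasure (distr (density lborel (\<lambda>t. ennreal (indicator {0<..} t / t))) lborel ln) (box l u)
      = (\<integral>\<^sup>+t. ennreal (indicator {0<..} t / t) * indicator (box l u) (ln t) \<partial>lborel)"
    by (rule emeasure_distr_density) auto
  \<comment> \<open>The indicator in the density removes the nonpositive reals, where
    \<open>ln\<close> has only a conventional value. The open interval is closed up at its two null
    endpoints to fit the fundamental theorem of calculus.\<close>
  also have "\<dots> = (\<integral>\<^sup>+t. ennreal (1 / t) * indicator {exp l..exp u} t \<partial>lborel)"
  proof (rule nn_integral_cong_AE)
    have "AE t in lborel. t \<noteq> exp l" "AE t in lborel. t \<noteq> exp u"
      by (rule AE_lborel_singleton)+
    then show "AE t in lborel. ennreal (indicator {0<..} t / t) * indicator (box l u) (ln t) =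
        ennreal (1 / t) * indicator {exp l..exp u} t"
    proof eventually_elim
      case (elim t)
      show ?case
      proof (cases "t > 0")
        case True
        then have "l < ln t \<longleftrightarrow> exp l < t" "ln t < u \<longleftrightarrow> t < exp u"
          using exp_less_cancel_iff[of l "ln t"] exp_less_cancel_iff[of "ln t" u] by simp_all
        then have "l < ln t \<and> ln t < u \<longleftrightarrow> exp l \<le> t \<and> t \<le> exp u"
          using elim by linarith
        then show ?thesis
          using True by (simp add: indicator_def box_real)
      next
        case False
        then have "t < exp l"
          using exp_gt_zero[of l] by linarith
        then show ?thesis
          using False by (simp add: indicator_def)
      qed
    qed
  qed
  also have "\<dots> = ennreal (ln (exp u) - ln (exp l))"
  proof (rule nn_integral_FTC_Icc)
    fix t assume "t \<in> {exp l..exp u}"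
    then have t: "t > 0" using exp_gt_zero[of l] unfolding atLeastAtMost_iff by linarith
    then show "(ln has_real_derivative 1 / t) (at t)"
      by (auto intro!: derivative_eq_intros)
    show "0 \<le> 1 / t" using t by simp
  qed (use lu in auto)
  finally show "emeasure (distr (density lborel (\<lambda>t. ennreal (indicator {0<..} t / t))) lborel ln) (box l u) =
      ennreal (\<Prod>b\<in>Basis. (u - l) \<bullet> b)"
    by simp
qed simp

lemma product_sigma_finite_lborel: "product_sigma_finite (\<lambda>_. lborel :: real measure)"
  by standard

lemma distr_ln_haar_PiM:
  fixes I :: "'i set"
  assumes "finite I"
  shows "distr (density (PiM I (\<lambda>_. lborel)) (\<lambda>t. \<Prod>i\<in>I. ennreal (indicator {0<..} (t i) / t i)))
    (PiM I (\<lambda>_. lborel)) (\<lambda>t. \<lambda>i\<in>I. ln (t i)) = PiM I (\<lambda>_. lborel)"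
proof -
  interpret product_sigma_finite "\<lambda>_::'i. lborel :: real measure"
    by (rule product_sigma_finite_lborel)
  show ?thesis
  proof (rule PiM_eqI[OF assms])
    fix A :: "'i \<Rightarrow> real set"
    assume A: "\<And>i. i \<in> I \<Longrightarrow> A i \<in> sets lborel"
    have [measurable]: "Pi\<^sub>E I A \<in> sets (PiM I (\<lambda>_. lborel))"
      using A assms by (intro sets_PiM_I_finite) auto
    have "emeasure (distr (density (PiM I (\<lambda>_. lborel)) (\<lambda>t. \<Prod>i\<in>I. ennreal (indicator {0<..} (t i) / t i)))
        (PiM I (\<lambda>_. lborel)) (\<lambda>t. \<lambda>i\<in>I. ln (t i))) (Pi\<^sub>E I A) =
      (\<integral>\<^sup>+t. (\<Prod>i\<in>I. ennreal (indicator {0<..} (t i) / t i)) * indicator (Pi\<^sub>E I A) (\<lambda>i\<in>I. ln (t i))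
         \<partial>PiM I (\<lambda>_. lborel))"
      by (rule emeasure_distr_density) measurable
    also have "\<dots> = (\<integral>\<^sup>+t. (\<Prod>i\<in>I. ennreal (indicator {0<..} (t i) / t i) * indicator (A i) (ln (t i)))
         \<partial>PiM I (\<lambda>_. lborel))"
      unfolding prod.distrib
    proof (intro nn_integral_cong arg_cong2[where f="(*)"] refl)
      fix t :: "'i \<Rightarrow> real"
      show "indicator (Pi\<^sub>E I A) (\<lambda>i\<in>I. ln (t i)) = (\<Prod>i\<in>I. indicator (A i) (ln (t i)) :: ennreal)"
        using assms by (auto simp: indicator_def PiE_iff)
    qed
    also have "\<dots> = (\<Prod>i\<in>I. \<integral>\<^sup>+t. ennreal (indicator {0<..} t / t) * indicator (A i) (ln t) \<partial>lborel)"
    proof (rule product_nn_integral_prod[OF assms])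
      fix i assume "i \<in> I"
      then have [measurable]: "A i \<in> sets borel" using A by simp
      show "(\<lambda>t. ennreal (indicator {0<..} t / t) * indicator (A i) (ln t)) \<in> borel_measurable lborel"
        by measurable
    qed
    also have "\<dots> = (\<Prod>i\<in>I. emeasure lborel (A i))"
    proof (rule prod.cong[OF refl])
      fix i assume "i \<in> I"
      then have [measurable]: "A i \<in> sets borel" using A by simp
      have "emeasure lborel (A i) =
          emeasure (distr (density lborel (\<lambda>t. ennreal (indicator {0<..} t / t))) lborel ln) (A i)"
        unfolding distr_ln_haar ..
      also have "\<dots> = (\<integral>\<^sup>+t. ennreal (indicator {0<..} t / t) * indicator (A i) (ln t) \<partial>lborel)"
        by (rule emeasure_distr_density) auto
      finally show "(\<integral>\<^sup>+t. ennreal (indicator {0<..} t / t) * indicator (A i) (ln t) \<partial>lborel) =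
          emeasure lborel (A i)" ..
    qed
    finally show "emeasure (distr (density (PiM I (\<lambda>_. lborel)) (\<lambda>t. \<Prod>i\<in>I. ennreal (indicator {0<..} (t i) / t i)))
        (PiM I (\<lambda>_. lborel)) (\<lambda>t. \<lambda>i\<in>I. ln (t i))) (Pi\<^sub>E I A) = (\<Prod>i\<in>I. emeasure lborel (A i))" .
  qed simp
qed

text \<open>The weight vanishes as soon as one coordinate is nonpositive, so the integral over the
  whole product space is an integral over the positive orthant.\<close>

lemma has_bochner_integral_log_coordinates:
  fixes h :: "('i \<Rightarrow> real) \<Rightarrow> 'b::{banach, second_countable_topology}"
  assumes "finite I" "has_bochner_integral (PiM I (\<lambda>_. lborel)) h v"
  shows "has_bochner_integral (PiM I (\<lambda>_. lborel))
    (\<lambda>t. (\<Prod>i\<in>I. indicator {0<..} (t i) / t i) *\<^sub>R h (\<lambda>i\<in>I. ln (t i))) v"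
proof -
  have [measurable]: "h \<in> borel_measurable (PiM I (\<lambda>_. lborel))"
    using assms(2) by (auto simp: has_bochner_integral_iff)
  have eq: "(\<Prod>i\<in>I. ennreal (indicator {0<..} (t i) / t i)) =
      ennreal (\<Prod>i\<in>I. indicator {0<..} (t i) / t i)" for t :: "'i \<Rightarrow> real"
    by (rule prod_ennreal) (simp add: indicator_def)
  have nn: "0 \<le> (\<Prod>i\<in>I. indicator {0<..} (t i) / t i)" for t :: "'i \<Rightarrow> real"
    by (rule prod_nonneg) (auto simp: indicator_def)
  have "has_bochner_integral (distr (density (PiM I (\<lambda>_. lborel))
      (\<lambda>t. ennreal (\<Prod>i\<in>I. indicator {0<..} (t i) / t i)))
    (PiM I (\<lambda>_. lborel)) (\<lambda>t. \<lambda>i\<in>I. ln (t i))) h v"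
    using assms(2) unfolding distr_ln_haar_PiM[OF assms(1), unfolded eq] .
  then show ?thesis
    by (simp add: has_bochner_integral_iff integrable_distr_eq integral_distr integrable_density
        integral_density nn)
qed

text \<open>An equivalence, because it is used from right to left: the Gamma integral is known in t
  and wanted in ln t.\<close>

lemma has_bochner_integral_log_coordinates_real:
  fixes h :: "real \<Rightarrow> 'b::{banach, second_countable_topology}"
  assumes [measurable]: "h \<in> borel_measurable borel"
  shows "has_bochner_integral lborel h v \<longleftrightarrow>
    has_bochner_integral lborel (\<lambda>t. (indicator {0<..} t / t) *\<^sub>R h (ln t)) v"
proof -
  have nn: "0 \<le> indicator {0<..} t / t" for t :: real
    by (auto simp: indicator_def)
  have "has_bochner_integral lborel h v \<longleftrightarrow>
     has_bochner_integral (distr (density lborel (\<lambda>t. ennreal (indicator {0<..} t / t))) lborel ln) h v"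
    unfolding distr_ln_haar ..
  then show ?thesis
    by (simp add: has_bochner_integral_iff integrable_distr_eq integral_distr integrable_density
        integral_density nn)
qed

text \<open>Besides its own variable, coordinate \<open>i\<close> involves only variables of
  strictly smaller rank. Adding an index of maximal rank therefore leaves the old coordinates
  untouched, and the new one is affine in the new variable with slope 1 or -1, so invariance of
  one-dimensional Lebesgue measure gives the step.\<close>

lemma distr_PiM_triangular:
  fixes I :: "'i set" and r :: "'i \<Rightarrow> nat" and a :: "'i \<Rightarrow> 'i \<Rightarrow> real"
  assumes "finite I" and "\<And>i. i \<in> I \<Longrightarrow> \<bar>a i i\<bar> = 1"
    and "\<And>i j. i \<in> I \<Longrightarrow> j \<in> I \<Longrightarrow> i \<noteq> j \<Longrightarrow> r i \<le> r j \<Longrightarrow> a i j = 0"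
  shows "distr (PiM I (\<lambda>_. lborel)) (PiM I (\<lambda>_. lborel)) (\<lambda>x. \<lambda>i\<in>I. \<Sum>j\<in>I. a i j * x j) =
    PiM I (\<lambda>_. lborel)"
  using assms
proof (induction I rule: finite_ranking_induct[where f = r])
  case empty
  have "distr (PiM {} (\<lambda>_. lborel)) (PiM {} (\<lambda>_. lborel)) (\<lambda>x. \<lambda>i\<in>{}. \<Sum>j\<in>{}. a i j * x j) =
      distr (PiM {} (\<lambda>_. lborel)) (PiM {} (\<lambda>_. lborel)) (\<lambda>x. x)"
    by (rule distr_cong) (simp_all add: space_PiM restrict_def)
  then show ?case by (simp only: distr_id)
next
  case (insert k I)
  show ?case
  proof (cases "k \<in> I")
    \<comment> \<open>The ranking induction does not promise a fresh index.\<close>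
    case True
    show ?thesis unfolding insert_absorb[OF True] by (rule insert.IH; rule insert.prems; simp)
  next
    case False
    interpret product_sigma_finite "\<lambda>_::'i. lborel :: real measure"
      by (rule product_sigma_finite_lborel)
    note [simp] = \<open>finite I\<close>
    define A where "A J x = (\<lambda>i\<in>J. \<Sum>j\<in>J. a i j * x j)" for J and x :: "'i \<Rightarrow> real"
    have A_measurable [measurable]: "A J \<in> PiM J (\<lambda>_. lborel) \<rightarrow>\<^sub>M PiM J (\<lambda>_. lborel)" for J
      unfolding A_def by measurable
    have akk: "a k k \<noteq> 0" "\<bar>a k k\<bar> = 1" using insert.prems(1)[of k] by auto
    have upd: "A (insert k I) (x(k := y)) = (A I x)(k := (\<Sum>j\<in>I. a k j * x j) + a k k * y)" for x y
    proof
      fix i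
      have "(\<Sum>j\<in>I. a i j * (if j = k then y else x j)) = (\<Sum>j\<in>I. a i j * x j)"
        using False by (intro sum.cong) auto
      moreover have "a i k = 0" if "i \<in> I"
        using insert.prems(2)[of i k] insert.hyps(2)[of i] that False by auto
      ultimately show "A (insert k I) (x(k := y)) i = ((A I x)(k := (\<Sum>j\<in>I. a k j * x j) + a k k * y)) i"
        using False by (cases "i = k") (auto simp: A_def restrict_def add_ac)
    qed
    have IH: "distr (PiM I (\<lambda>_. lborel)) (PiM I (\<lambda>_. lborel)) (A I) = PiM I (\<lambda>_. lborel)"
      unfolding A_def by (rule insert.IH; rule insert.prems; simp)
    show ?thesis
      unfolding A_def[symmetric]
    proof (rule measure_eqI)
      fix B assume "B \<in> sets (distr (PiM (insert k I) (\<lambda>_. lborel)) (PiM (insert k I) (\<lambda>_. lborel)) (A (insert k I)))"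
      then have [measurable]: "B \<in> sets (PiM (insert k I) (\<lambda>_. lborel))" by simp
      have "emeasure (distr (PiM (insert k I) (\<lambda>_. lborel)) (PiM (insert k I) (\<lambda>_. lborel)) (A (insert k I))) B
        = (\<integral>\<^sup>+x. indicator B (A (insert k I) x) \<partial>PiM (insert k I) (\<lambda>_. lborel))"
        by (subst nn_integral_indicator[symmetric], simp, rule nn_integral_distr) measurable
      also have "\<dots> = (\<integral>\<^sup>+x. \<integral>\<^sup>+y. indicator B (A (insert k I) (x(k := y))) \<partial>lborel \<partial>PiM I (\<lambda>_. lborel))"
        by (rule product_nn_integral_insert[OF \<open>finite I\<close> False]) measurable
      also have "\<dots> = (\<integral>\<^sup>+x. \<integral>\<^sup>+y. indicator B ((A I x)(k := y)) \<partial>lborel \<partial>PiM I (\<lambda>_. lborel))"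
      proof (rule nn_integral_cong)
        fix x :: "'i \<Rightarrow> real" assume "x \<in> space (PiM I (\<lambda>_. lborel))"
        have sp: "A I x \<in> space (PiM I (\<lambda>_. lborel))" by (simp add: A_def space_PiM)
        have "(\<lambda>y. indicator B ((A I x)(k := y)) :: ennreal) \<in> borel_measurable (lborel :: real measure)"
          by (rule measurable_compose[OF measurable_component_update[OF sp False]]) simp
        then have "(\<integral>\<^sup>+y. indicator B ((A I x)(k := y)) \<partial>lborel) = ennreal \<bar>a k k\<bar> *
            (\<integral>\<^sup>+y. indicator B ((A I x)(k := (\<Sum>j\<in>I. a k j * x j) + a k k * y)) \<partial>lborel)"
          unfolding measurable_cong_sets[OF sets_lborel refl] by (rule nn_integral_real_affine[OF _ akk(1)])
        then show "(\<integral>\<^sup>+y. indicator B (A (insert k I) (x(k := y))) \<partial>lborel) =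
            (\<integral>\<^sup>+y. indicator B ((A I x)(k := y)) \<partial>lborel)"
          by (simp only: upd akk(2) ennreal_1 mult_1)
      qed
      also have "\<dots> = (\<integral>\<^sup>+x. \<integral>\<^sup>+y. indicator B (x(k := y)) \<partial>lborel \<partial>distr (PiM I (\<lambda>_. lborel)) (PiM I (\<lambda>_. lborel)) (A I))"
        by (subst nn_integral_distr) measurable
      also have "\<dots> = (\<integral>\<^sup>+x. indicator B x \<partial>PiM (insert k I) (\<lambda>_. lborel))"
        unfolding IH by (rule product_nn_integral_insert[OF \<open>finite I\<close> False, symmetric]) measurable
      finally show "emeasure (distr (PiM (insert k I) (\<lambda>_. lborel)) (PiM (insert k I) (\<lambda>_. lborel)) (A (insert k I))) B
         = emeasure (PiM (insert k I) (\<lambda>_. lborel)) B" by simp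
    qed simp
  qed
qed

lemma has_bochner_integral_triangular:
  fixes I :: "'i set" and r :: "'i \<Rightarrow> nat" and a :: "'i \<Rightarrow> 'i \<Rightarrow> real"
    and f :: "('i \<Rightarrow> real) \<Rightarrow> 'b::{banach, second_countable_topology}"
  assumes "finite I" and "\<And>i. i \<in> I \<Longrightarrow> \<bar>a i i\<bar> = 1"
    and "\<And>i j. i \<in> I \<Longrightarrow> j \<in> I \<Longrightarrow> i \<noteq> j \<Longrightarrow> r i \<le> r j \<Longrightarrow> a i j = 0"
    and "has_bochner_integral (PiM I (\<lambda>_. lborel)) f v"
  shows "has_bochner_integral (PiM I (\<lambda>_. lborel)) (\<lambda>x. f (\<lambda>i\<in>I. \<Sum>j\<in>I. a i j * x j)) v"
proof -
  have "has_bochner_integral (distr (PiM I (\<lambda>_. lborel)) (PiM I (\<lambda>_. lborel))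
      (\<lambda>x. \<lambda>i\<in>I. \<Sum>j\<in>I. a i j * x j)) f v"
    using assms(4) by (subst distr_PiM_triangular[of I a r]) (use assms in auto)
  moreover have "f \<in> borel_measurable (PiM I (\<lambda>_. lborel))"
    using assms(4) by (auto simp: has_bochner_integral_iff)
  ultimately show ?thesis
    by (simp add: has_bochner_integral_iff integrable_distr_eq integral_distr)
qed

lemma has_bochner_integral_PiM_prod:
  fixes f :: "'i \<Rightarrow> real \<Rightarrow> 'b::{real_normed_field, banach, second_countable_topology}"
  assumes "finite I" "\<And>i. i \<in> I \<Longrightarrow> has_bochner_integral lborel (f i) (v i)"
  shows "has_bochner_integral (PiM I (\<lambda>_. lborel)) (\<lambda>x. \<Prod>i\<in>I. f i (x i)) (\<Prod>i\<in>I. v i)"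
proof -
  interpret product_sigma_finite "\<lambda>_::'i. lborel :: real measure"
    by (rule product_sigma_finite_lborel)
  show ?thesis
    using assms by (auto simp: has_bochner_integral_iff product_integral_prod product_integrable_prod)
qed

subsection \<open>Mellin-Barnes inversion for the Gamma function\<close>

text \<open>Euler's integral in the variable w = ln t. In this form it is a Fourier integral over
  the whole line, which serves the inversion below, and a linear change of w acts on it
  directly.\<close>

lemma Gamma_log_has_bochner_integral:
  fixes z :: complex
  assumes z: "Re z > 0"
  shows "has_bochner_integral lborel (\<lambda>w. exp (z * of_real w - of_real (exp w))) (Gamma z)"
proof (subst has_bochner_integral_log_coordinates_real)
  have eq: "(indicator {0<..} t / t) *\<^sub>R exp (z * of_real (ln t) - of_real (exp (ln t))) =
      indicator {0<..} t *\<^sub>R (of_real t powr (z - 1) / of_real (exp t))" for t :: real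
  proof (cases "t > 0")
    case True
    then have "of_real t = exp (of_real (ln t) :: complex)"
      by (simp add: exp_of_real)
    moreover have "(of_real t :: complex) powr (z - 1) = exp ((z - 1) * of_real (ln t))"
      using True by (simp add: powr_def Ln_of_real)
    ultimately have "exp (z * of_real (ln t) - of_real t) =
        of_real t * (of_real t powr (z - 1) / of_real (exp t) :: complex)"
      using True by (simp add: exp_diff exp_of_real ring_distribs flip: exp_add)
    then show ?thesis using True by (simp add: scaleR_conv_of_real)
  qed auto
  have abs: "(\<lambda>t. of_real t powr (z - 1) / of_real (exp t) :: complex) absolutely_integrable_on {0<..}"
    using absolutely_integrable_Gamma_integral'[OF z] by simp
  have m: "(\<lambda>t. indicator {0<..} t *\<^sub>R (of_real t powr (z - 1) / of_real (exp t)) :: complex)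
      \<in> borel_measurable lborel"
    unfolding eq[symmetric] by measurable
  have int: "integrable lborel (\<lambda>t. indicator {0<..} t *\<^sub>R (of_real t powr (z - 1) / of_real (exp t)) :: complex)"
    using abs m unfolding set_integrable_def by (simp add: integrable_completion)
  \<comment> \<open>Euler's integral is available as a gauge integral. Absolute integrability
    identifies it with the integral over the completed measure, which agrees with
    \<open>lborel\<close> on Borel functions.\<close>
  have "(LINT t|lborel. indicator {0<..} t *\<^sub>R (of_real t powr (z - 1) / of_real (exp t))) =
      (LINT t:{0<..}|lebesgue. of_real t powr (z - 1) / of_real (exp t))"
    unfolding set_lebesgue_integral_def by (rule integral_completion[OF m, symmetric])
  also have "\<dots> = Gamma z"
    using has_integral_set_lebesgue[OF abs] Gamma_integral_complex'[OF z] by (rule has_integral_unique)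
  finally show "has_bochner_integral lborel
     (\<lambda>t. (indicator {0<..} t / t) *\<^sub>R exp (z * of_real (ln t) - of_real (exp (ln t)))) (Gamma z)"
    unfolding eq using int by (simp add: has_bochner_integral_iff)
qed measurable

text \<open>The bound is the real Gamma integral at Re z, hence uniform along a vertical
  line.\<close>

lemma norm_Gamma_le:
  fixes z :: complex
  assumes "Re z > 0"
  shows "norm (Gamma z) \<le> (LINT w|lborel. exp (Re z * w - exp w))"
proof -
  have "norm (Gamma z) \<le> (LINT w|lborel. norm (exp (z * of_real w - of_real (exp w))))"
    using Gamma_log_has_bochner_integral[OF assms]
    by (metis has_bochner_integral_integral_eq integral_norm_bound)
  then show ?thesis by simp
qed

lemma Re_pos_not_nonpos_Int: "Re z > 0 \<Longrightarrow> z \<notin> \<int>\<^sub>\<le>\<^sub>0"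
  by (auto elim!: nonpos_Ints_cases)

lemma continuous_on_Gamma_vertical:
  assumes "c > 0"
  shows "continuous_on A (\<lambda>y. Gamma (of_real c + \<i> * of_real y :: complex))"
proof (intro continuous_at_imp_continuous_on ballI isCont_Gamma)
  fix y assume "y \<in> A"
  show "isCont (\<lambda>y. of_real c + \<i> * of_real y :: complex) y"
    by (intro continuous_intros)
  have "Re (of_real c + \<i> * of_real y) > 0" using assms by simp
  then show "of_real c + \<i> * of_real y \<notin> \<int>\<^sub>\<le>\<^sub>0"
    by (rule Re_pos_not_nonpos_Int)
qed

text \<open>Quadratic decay is enough: Gamma z = Gamma (z + 2) / (z (z + 1)), where the numerator is
  bounded on the line and the denominator has modulus at least c^2 + y^2.\<close>

lemma integrable_Gamma_vertical:
  assumes c: "c > 0"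
  shows "integrable lborel (\<lambda>y. Gamma (of_real c + \<i> * of_real y :: complex))"
proof (rule Bochner_Integration.integrable_bound)
  \<comment> \<open>The integral bounds \<open>Gamma\<close> on the line of real part c + 2; the
    factor 1 + 1 / c^2 turns 1 / (c^2 + y^2) into a multiple of 1 / (1 + y^2).\<close>
  let ?K = "(LINT w|lborel. exp ((c + 2) * w - exp w)) * (1 + 1 / c\<^sup>2)"
  show "integrable lborel (\<lambda>y. ?K * inverse (1 + y\<^sup>2))"
    using integrable_inverse_1_plus_square by (simp add: set_integrable_def)
  show "(\<lambda>y. Gamma (of_real c + \<i> * of_real y :: complex)) \<in> borel_measurable lborel"
    using continuous_on_Gamma_vertical[OF c, of UNIV] by (simp add: borel_measurable_continuous_onI)
  have "norm (Gamma (of_real c + \<i> * of_real y :: complex)) \<le> norm (?K * inverse (1 + y\<^sup>2))" for y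
  proof -
    define z where "z = complex_of_real c + \<i> * of_real y"
    have Rez: "Re z = c" "Im z = y" by (simp_all add: z_def)
    have nz: "z \<noteq> 0" "z + 1 \<noteq> 0" using c Rez by (auto simp: complex_eq_iff)
    have "Gamma (z + 1 + 1) = (z + 1) * Gamma (z + 1)" "Gamma (z + 1) = z * Gamma z"
      using c Rez by (intro Gamma_plus1 Re_pos_not_nonpos_Int; simp)+
    then have "Gamma (z + 2) = z * (z + 1) * Gamma z"
      by (simp add: algebra_simps)
    then have eq: "Gamma z = Gamma (z + 2) / (z * (z + 1))"
      using nz by simp
    have N: "norm (Gamma (z + 2)) \<le> (LINT w|lborel. exp ((c + 2) * w - exp w))"
      using norm_Gamma_le[of "z + 2"] c Rez by simp
    have "1 / norm (z * (z + 1)) \<le> 1 / (c\<^sup>2 + y\<^sup>2)"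
    proof (rule divide_left_mono)
      have "norm z \<le> norm (z + 1)"
        unfolding cmod_def using c Rez by (intro real_sqrt_le_mono) (simp add: power2_eq_square algebra_simps)
      then have "norm z * norm z \<le> norm z * norm (z + 1)"
        by (intro mult_left_mono) auto
      moreover have "norm z * norm z = c\<^sup>2 + y\<^sup>2"
        using cmod_power2[of z] Rez by (simp add: power2_eq_square)
      ultimately show "c\<^sup>2 + y\<^sup>2 \<le> norm (z * (z + 1))"
        unfolding norm_mult by simp
    qed (use c nz in \<open>auto intro!: mult_pos_pos add_pos_nonneg\<close>)
    also have "1 / (c\<^sup>2 + y\<^sup>2) \<le> (1 + 1 / c\<^sup>2) * inverse (1 + y\<^sup>2)"
    proof -
      have "1 + y\<^sup>2 \<le> (1 + 1 / c\<^sup>2) * (c\<^sup>2 + y\<^sup>2)"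
        using c by (simp add: field_simps)
      moreover have "c\<^sup>2 + y\<^sup>2 > 0" "1 + y\<^sup>2 > 0"
        using c by (auto intro!: add_pos_nonneg)
      ultimately show ?thesis
        by (simp add: divide_simps mult.commute)
    qed
    finally have "norm (Gamma (z + 2)) * (1 / norm (z * (z + 1))) \<le>
        (LINT w|lborel. exp ((c + 2) * w - exp w)) * ((1 + 1 / c\<^sup>2) * inverse (1 + y\<^sup>2))"
      using N by (intro mult_mono) auto
    then have "norm (Gamma z) \<le> ?K * inverse (1 + y\<^sup>2)"
      by (subst eq) (simp add: norm_divide mult.assoc)
    then show ?thesis unfolding z_def by (rule order_trans) simp
  qed
  then show "AE y in lborel. norm (Gamma (of_real c + \<i> * of_real y :: complex)) \<le> norm (?K * inverse (1 + y\<^sup>2))"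
    by simp
qed

lemma integral_iexp_std_normal_density:
  "(LINT z|lborel. std_normal_density z *\<^sub>R iexp (s * z)) = complex_of_real (exp (- s\<^sup>2 / 2))"
proof -
  have "(LINT z|lborel. std_normal_density z *\<^sub>R iexp (s * z)) = char std_normal_distribution s"
    unfolding char_def by (subst integral_density) auto
  then show ?thesis by (simp add: char_std_normal_distribution)
qed

text \<open>The result is again written with a normal density, now of width \<open>e\<close> in
  \<open>s\<close>, so that it acts as an approximate identity (up to the mass sqrt (2 pi)) when
  \<open>e\<close> tends to 0.\<close>

lemma integral_iexp_scaled_normal_density:
  assumes e: "e > 0"
  shows "(LINT y|lborel. std_normal_density (e * y) *\<^sub>R iexp (s * y)) =
    complex_of_real (sqrt (2 * pi) / e * std_normal_density (s / e))"
proof -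
  have "(LINT z|lborel. std_normal_density z *\<^sub>R iexp (s / e * z)) =
      \<bar>e\<bar> *\<^sub>R (LINT y|lborel. std_normal_density (0 + e * y) *\<^sub>R iexp (s / e * (0 + e * y)))"
    using e by (intro lborel_integral_real_affine) auto
  also have "\<dots> = e *\<^sub>R (LINT y|lborel. std_normal_density (e * y) *\<^sub>R iexp (s * y))"
    using e by simp
  finally have "(LINT y|lborel. std_normal_density (e * y) *\<^sub>R iexp (s * y)) =
      (1 / e) *\<^sub>R complex_of_real (exp (- (s / e)\<^sup>2 / 2))"
    using e unfolding integral_iexp_std_normal_density by simp
  then show ?thesis
    by (simp add: std_normal_density_def scaleR_conv_of_real)
qed

text \<open>
  Inserting the Gaussian factor \<open>std_normal_density (e y)\<close> makes Fubini applicable; as \<open>e\<close> tends to \<open>0\<close> the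
  two sides of the resulting identity converge to the two sides of the claim.
\<close>

lemma fourier_inversion:
  fixes g :: "real \<Rightarrow> complex"
  assumes cont: "continuous_on UNIV g" and bound: "\<And>u. norm (g u) \<le> B" and g: "integrable lborel g"
    and \<phi>: "\<And>y. \<phi> y = (LINT u|lborel. g u * iexp (u * y))" and int_\<phi>: "integrable lborel \<phi>"
  shows "(LINT y|lborel. \<phi> y * iexp (- (v * y))) = 2 * pi * g v"
proof -
  define e where "e = (\<lambda>n. inverse (real (Suc n)))"
  have e: "e n > 0" for n by (simp add: e_def)
  have e_lim: "e \<longlonglongrightarrow> 0" unfolding e_def by (rule LIMSEQ_inverse_real_of_nat)
  have [measurable]: "g \<in> borel_measurable borel" using cont by (rule borel_measurable_continuous_onI)
  have [measurable]: "\<phi> \<in> borel_measurable borel" using int_\<phi> by auto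
  have sd0: "std_normal_density 0 = 1 / sqrt (2 * pi)" by (simp add: std_normal_density_def)
  have sd_cont: "isCont std_normal_density x" for x
    unfolding std_normal_density_def by (intro continuous_intros) auto
  define J where "J n = (LINT y|lborel. std_normal_density (e n * y) *\<^sub>R (\<phi> y * iexp (- (v * y))))" for n
  have "J \<longlonglongrightarrow> (LINT y|lborel. std_normal_density 0 *\<^sub>R (\<phi> y * iexp (- (v * y))))"
    unfolding J_def
  proof (rule integral_dominated_convergence[where w = "\<lambda>y. std_normal_density 0 * norm (\<phi> y)"])
    show "AE y in lborel. (\<lambda>n. std_normal_density (e n * y) *\<^sub>R (\<phi> y * iexp (- (v * y))))
        \<longlonglongrightarrow> std_normal_density 0 *\<^sub>R (\<phi> y * iexp (- (v * y)))"
    proof (intro AE_I2 tendsto_intros isCont_tendsto_compose[OF sd_cont])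
      fix y show "(\<lambda>n. e n * y) \<longlonglongrightarrow> 0" using tendsto_mult_left_zero[OF e_lim] .
    qed
    show "AE y in lborel. norm (std_normal_density (e n * y) *\<^sub>R (\<phi> y * iexp (- (v * y))))
        \<le> std_normal_density 0 * norm (\<phi> y)" for n
      by (intro AE_I2) (auto simp: norm_mult std_normal_density_def intro!: divide_right_mono mult_left_le_one_le)
  qed (use int_\<phi> in auto)
  moreover have "J \<longlonglongrightarrow> sqrt (2 * pi) * g v"
  proof -
    \<comment> \<open>Swapping the integrals turns the Gaussian cutoff in y into a Gaussian
      concentrated at v; the substitution u = v + e n * z rescales it to unit width.\<close>
    have "J = (\<lambda>n. sqrt (2 * pi) * (LINT z|lborel. std_normal_density z *\<^sub>R g (v + e n * z)))"
    proof
      fix n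
      have int: "integrable (lborel \<Otimes>\<^sub>M lborel)
          (\<lambda>(y, u). std_normal_density (e n * y) *\<^sub>R (g u * iexp ((u - v) * y)))"
      proof (rule integrable_pair_bound[where a = "\<lambda>y. std_normal_density (e n * y)" and b = "\<lambda>u. norm (g u)"])
        show "integrable lborel (\<lambda>u. norm (g u))" using g by simp
        show "integrable lborel (\<lambda>y. std_normal_density (e n * y))"
          using e[of n] by (intro lborel_integrable_real_affine[of std_normal_density _ 0, simplified])
            (auto simp: integrable_normal_density)
      qed (auto simp: norm_mult sigma_finite_lborel)
      have "J n = (LINT y|lborel. LINT u|lborel. std_normal_density (e n * y) *\<^sub>R (g u * iexp ((u - v) * y)))"
        unfolding J_def
      proof (intro Bochner_Integration.integral_cong refl)
        fix y
        have "(LINT u|lborel. std_normal_density (e n * y) *\<^sub>R (g u * iexp ((u - v) * y))) =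
          (LINT u|lborel. std_normal_density (e n * y) *\<^sub>R ((g u * iexp (u * y)) * iexp (- (v * y))))"
          by (intro Bochner_Integration.integral_cong) (auto simp: algebra_simps simp flip: exp_add)
        also have "\<dots> = std_normal_density (e n * y) *\<^sub>R (\<phi> y * iexp (- (v * y)))"
          unfolding \<phi> by simp
        finally show "std_normal_density (e n * y) *\<^sub>R (\<phi> y * iexp (- (v * y))) =
            (LINT u|lborel. std_normal_density (e n * y) *\<^sub>R (g u * iexp ((u - v) * y)))" ..
      qed
      also have "\<dots> = (LINT u|lborel. LINT y|lborel. std_normal_density (e n * y) *\<^sub>R (g u * iexp ((u - v) * y)))"
        by (rule lborel_pair.Fubini_integral[symmetric]) (rule int)
      also have "\<dots> = (LINT u|lborel. g u * complex_of_real (sqrt (2 * pi) / e n * std_normal_density ((u - v) / e n)))"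
      proof (intro Bochner_Integration.integral_cong refl)
        fix u
        have "(LINT y|lborel. std_normal_density (e n * y) *\<^sub>R (g u * iexp ((u - v) * y))) =
          (LINT y|lborel. g u * (std_normal_density (e n * y) *\<^sub>R iexp ((u - v) * y)))"
          by (intro Bochner_Integration.integral_cong) auto
        also have "\<dots> = g u * (LINT y|lborel. std_normal_density (e n * y) *\<^sub>R iexp ((u - v) * y))"
          by (rule integral_mult_right_zero)
        finally show "(LINT y|lborel. std_normal_density (e n * y) *\<^sub>R (g u * iexp ((u - v) * y))) =
            g u * complex_of_real (sqrt (2 * pi) / e n * std_normal_density ((u - v) / e n))"
          unfolding integral_iexp_scaled_normal_density[OF e] .
      qed
      also have "\<dots> = \<bar>e n\<bar> *\<^sub>R (LINT z|lborel. g (v + e n * z) *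
          complex_of_real (sqrt (2 * pi) / e n * std_normal_density ((v + e n * z - v) / e n)))"
        using e[of n] by (intro lborel_integral_real_affine) auto
      also have "\<dots> = (LINT z|lborel. sqrt (2 * pi) * (std_normal_density z *\<^sub>R g (v + e n * z)))"
        using e[of n] by (subst integral_scaleR_right[symmetric], intro Bochner_Integration.integral_cong refl)
          (auto simp: scaleR_conv_of_real)
      finally show "J n = sqrt (2 * pi) * (LINT z|lborel. std_normal_density z *\<^sub>R g (v + e n * z))"
        by (simp only: integral_mult_right_zero)
    qed
    moreover have "(\<lambda>n. LINT z|lborel. std_normal_density z *\<^sub>R g (v + e n * z)) \<longlonglongrightarrow>
        (LINT z|lborel. std_normal_density z *\<^sub>R g v)"
    proof (rule integral_dominated_convergence[where w = "\<lambda>z. std_normal_density z * B"])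
      show "AE z in lborel. (\<lambda>n. std_normal_density z *\<^sub>R g (v + e n * z)) \<longlonglongrightarrow> std_normal_density z *\<^sub>R g v"
      proof (intro AE_I2 tendsto_intros)
        fix z
        have "(\<lambda>n. v + e n * z) \<longlonglongrightarrow> v + 0 * z" by (intro tendsto_intros e_lim)
        then show "(\<lambda>n. g (v + e n * z)) \<longlonglongrightarrow> g v"
          using cont by (intro isCont_tendsto_compose[of _ g]) (auto simp: continuous_on_eq_continuous_at)
      qed
    qed (auto intro!: mult_left_mono bound integrable_normal_density)
    moreover have "(LINT z|lborel. std_normal_density z *\<^sub>R g v) = g v"
      by simp
    ultimately show ?thesis by (simp only:) (intro tendsto_intros)
  qed
  \<comment> \<open>The cutoff tends to 1 / sqrt (2 pi) and the concentrated Gaussian has mass sqrt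
    (2 pi); the quotient of the two is the factor 2 pi.\<close>
  ultimately have "(LINT y|lborel. std_normal_density 0 *\<^sub>R (\<phi> y * iexp (- (v * y)))) = sqrt (2 * pi) * g v"
    by (rule LIMSEQ_unique)
  then have "(LINT y|lborel. \<phi> y * iexp (- (v * y))) / sqrt (2 * pi) = sqrt (2 * pi) * g v"
    by (simp add: sd0 scaleR_conv_of_real divide_inverse mult.commute)
  then have "(LINT y|lborel. \<phi> y * iexp (- (v * y))) / sqrt (2 * pi) * sqrt (2 * pi) =
      (complex_of_real (sqrt (2 * pi)) * complex_of_real (sqrt (2 * pi))) * g v"
    by (simp only: mult_ac)
  moreover have "complex_of_real (sqrt (2 * pi)) * complex_of_real (sqrt (2 * pi)) = 2 * pi"
    by (simp flip: of_real_mult)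
  ultimately show ?thesis by simp
qed

text \<open>On the line of real part c, \<open>Gamma\<close> is the Fourier transform of u -> exp (c
  u - exp u). Inverting at v and multiplying by exp (- c v) gives the formula.\<close>

lemma mellin_barnes_exp:
  assumes c: "c > 0"
  shows "has_bochner_integral lborel
    (\<lambda>y. Gamma (of_real c + \<i> * of_real y) * exp (- ((of_real c + \<i> * of_real y) * of_real v)))
    (complex_of_real (2 * pi * exp (- exp v)))"
proof -
  define g where "g u = complex_of_real (exp (c * u - exp u))" for u
  \<comment> \<open>The exponent c u - exp u is maximal at u = ln c; the bound is 1 + s \<le> exp s
    at s = u - ln c.\<close>
  have bound: "norm (g u) \<le> exp (c * ln c - c)" for u
  proof -
    have "c * (1 + (u - ln c)) \<le> c * exp (u - ln c)"
      using c by (intro mult_left_mono exp_ge_add_one_self) auto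
    then have "c + c * u - c * ln c \<le> exp u"
      using c by (simp add: exp_diff algebra_simps)
    then show ?thesis by (simp add: g_def)
  qed
  have \<phi>: "has_bochner_integral lborel (\<lambda>u. g u * iexp (u * y)) (Gamma (of_real c + \<i> * of_real y))" for y
    using Gamma_log_has_bochner_integral[of "of_real c + \<i> * of_real y"] c
    by (simp add: g_def algebra_simps flip: exp_add exp_of_real)
  have int_g: "integrable lborel g"
    using \<phi>[of 0] by (simp add: has_bochner_integral_iff)
  have int: "integrable lborel (\<lambda>y. Gamma (of_real c + \<i> * of_real y) * exp (- ((of_real c + \<i> * of_real y) * of_real v)))"
  proof (rule Bochner_Integration.integrable_bound)
    show "integrable lborel (\<lambda>y. exp (- (c * v)) *\<^sub>R Gamma (of_real c + \<i> * of_real y :: complex))"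
      using integrable_Gamma_vertical[OF c] by simp
    show "(\<lambda>y. Gamma (of_real c + \<i> * of_real y) * exp (- ((of_real c + \<i> * of_real y) * of_real v)))
      \<in> borel_measurable lborel"
      using borel_measurable_integrable[OF integrable_Gamma_vertical[OF c]] by simp
  qed (simp add: norm_mult)
  have "(LINT y|lborel. Gamma (of_real c + \<i> * of_real y) * exp (- ((of_real c + \<i> * of_real y) * of_real v))) =
    (LINT y|lborel. exp (- of_real (c * v)) * (Gamma (of_real c + \<i> * of_real y) * iexp (- (v * y))))"
    by (intro Bochner_Integration.integral_cong) (auto simp: algebra_simps simp flip: exp_add)
  also have "\<dots> = exp (- of_real (c * v)) * (LINT y|lborel. Gamma (of_real c + \<i> * of_real y) * iexp (- (v * y)))"
    by simp
  also have "(LINT y|lborel. Gamma (of_real c + \<i> * of_real y) * iexp (- (v * y))) = 2 * pi * g v"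
  proof (rule fourier_inversion[OF _ bound int_g])
    show "continuous_on UNIV g" unfolding g_def by (intro continuous_intros)
    show "Gamma (of_real c + \<i> * of_real y) = (LINT u|lborel. g u * iexp (u * y))" for y
      using \<phi> by (simp add: has_bochner_integral_iff)
  qed (rule integrable_Gamma_vertical[OF c])
  also have "exp (- of_real (c * v)) * (2 * pi * g v) = complex_of_real (2 * pi * exp (- exp v))"
  proof -
    have "exp (- of_real (c * v)) * g v = complex_of_real (exp (- (c * v)) * exp (c * v - exp v))"
      unfolding g_def by (simp add: exp_of_real flip: of_real_minus of_real_mult)
    then show ?thesis by (simp flip: exp_add)
  qed
  finally show ?thesis using int by (simp add: has_bochner_integral_iff)
qed

subsection \<open>Gauss factorizations\<close>

definition upper_unipotent :: "nat \<Rightarrow> real mat set" where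
  "upper_unipotent n = {U \<in> carrier_mat n n.
     (\<forall>r<n. U $$ (r, r) = 1) \<and> (\<forall>r<n. \<forall>s<n. s < r \<longrightarrow> U $$ (r, s) = 0)}"

lemma index_mult_mat_sum:
  "A \<in> carrier_mat n m \<Longrightarrow> B \<in> carrier_mat m l \<Longrightarrow> r < n \<Longrightarrow> s < l \<Longrightarrow>
    (A * B) $$ (r, s) = (\<Sum>k<m. A $$ (r, k) * B $$ (k, s))"
  by (auto simp: scalar_prod_def atLeast0LessThan intro!: sum.cong)

lemma upper_unipotent_mult:
  assumes "A \<in> upper_unipotent n" "B \<in> upper_unipotent n"
  shows "A * B \<in> upper_unipotent n"
proof -
  have carr: "A \<in> carrier_mat n n" "B \<in> carrier_mat n n"
    using assms by (auto simp: upper_unipotent_def)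
  have zero: "A $$ (r, k) * B $$ (k, s) = 0" if "r < n" "s < n" "k < n" "s \<le> r" "k \<noteq> r \<or> s \<noteq> r" for r s k
    using assms that by (cases "k < r") (auto simp: upper_unipotent_def)
  have "(A * B) $$ (r, s) = (if s = r then 1 else 0)" if "r < n" "s < n" "s \<le> r" for r s
  proof -
    have "(A * B) $$ (r, s) = (\<Sum>k<n. A $$ (r, k) * B $$ (k, s))"
      using carr that by (intro index_mult_mat_sum)
    also have "\<dots> = (\<Sum>k<n. if k = r then (if s = r then 1 else 0) else 0)"
      using assms that by (intro sum.cong) (auto simp: zero upper_unipotent_def)
    finally show ?thesis using that by simp
  qed
  then show ?thesis using carr by (auto simp: upper_unipotent_def)
qed

lemma upper_unipotent_one: "1\<^sub>m n \<in> upper_unipotent n"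
  by (auto simp: upper_unipotent_def)

lemma mat_product_Nil [simp]: "mat_product n [] = 1\<^sub>m n"
  and mat_product_Cons [simp]: "mat_product n (A # As) = A * mat_product n As"
  by (simp_all add: mat_product_def)

lemma mat_product_carrier:
  "set As \<subseteq> carrier_mat n n \<Longrightarrow> mat_product n As \<in> carrier_mat n n"
  by (induction As) (auto intro: mult_carrier_mat)

lemma mat_product_append:
  assumes "set As \<subseteq> carrier_mat n n" "set Bs \<subseteq> carrier_mat n n"
  shows "mat_product n (As @ Bs) = mat_product n As * mat_product n Bs"
  using assms
proof (induction As)
  case Nil
  then show ?case using left_mult_one_mat[OF mat_product_carrier, of Bs n] by simp
next
  case (Cons A As)
  then show ?case
    using assoc_mult_mat[of A n n "mat_product n As" n "mat_product n Bs" n]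
    by (simp add: mat_product_carrier)
qed

lemma mat_product_upper_unipotent:
  "set As \<subseteq> upper_unipotent n \<Longrightarrow> mat_product n As \<in> upper_unipotent n"
  by (induction As) (auto intro: upper_unipotent_mult upper_unipotent_one)

lemma matrix_unit_carrier [simp]: "matrix_unit n a b \<in> carrier_mat n n"
  by (simp add: matrix_unit_def)

lemma elementary_upper_unipotent:
  "a < b \<Longrightarrow> 1\<^sub>m n + c \<cdot>\<^sub>m matrix_unit n a b \<in> upper_unipotent n"
  by (auto simp: upper_unipotent_def matrix_unit_def)

lemma Rmat_upper_unipotent: "Rmat n t i \<in> upper_unipotent n"
  unfolding Rmat_def by (rule mat_product_upper_unipotent) (auto intro!: elementary_upper_unipotent)

lemma Xmat_upper_unipotent: "Xmat n t \<in> upper_unipotent n"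
  unfolding Xmat_def by (rule mat_product_upper_unipotent) (auto intro!: Rmat_upper_unipotent)

lemma Rmat_carrier [simp]: "Rmat n t i \<in> carrier_mat n n"
  using Rmat_upper_unipotent[of n t i] by (simp add: upper_unipotent_def)

lemma Xmat_carrier [simp]: "Xmat n t \<in> carrier_mat n n"
  using Xmat_upper_unipotent[of n t] by (simp add: upper_unipotent_def)

lemma Rmat_cong:
  assumes "\<And>ij. ij \<in> pairs n \<Longrightarrow> t ij = t' ij" "1 \<le> i"
  shows "Rmat n t i = Rmat n t' i"
  unfolding Rmat_def using assms
  by (intro arg_cong[where f="mat_product n"] map_cong refl) (auto simp: pairs_def)

lemma Xmat_cong:
  assumes "\<And>ij. ij \<in> pairs n \<Longrightarrow> t ij = t' ij"
  shows "Xmat n t = Xmat n t'"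
  unfolding Xmat_def
  by (intro arg_cong[where f="mat_product n"] map_cong refl Rmat_cong assms) auto

section \<open>Uniqueness of triangular factorizations\<close>

lemma index_mult_diag_mult:
  assumes "Y \<in> carrier_mat n n" "T \<in> carrier_mat n n" "diagonal_mat T" "U \<in> carrier_mat n n" "r < n" "s < n"
  shows "(Y * T * U) $$ (r, s) = (\<Sum>k<n. Y $$ (r, k) * T $$ (k, k) * U $$ (k, s))"
proof -
  have "(Y * T) $$ (r, k) = Y $$ (r, k) * T $$ (k, k)" if "k < n" for k
  proof -
    have "(Y * T) $$ (r, k) = (\<Sum>j<n. Y $$ (r, j) * T $$ (j, k))"
      using assms that by (intro index_mult_mat_sum)
    also have "\<dots> = (\<Sum>j<n. if j = k then Y $$ (r, k) * T $$ (k, k) else 0)"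
      using assms that by (intro sum.cong) (auto simp: diagonal_mat_def)
    finally show ?thesis using that by simp
  qed
  then show ?thesis
    using assms by (subst index_mult_mat_sum[of _ n n]) auto
qed

text \<open>
  The \<open>k\<close>-th term of an entry in row or column \<open>k\<close> of the product is determined by the earlier ones, so
  row \<open>k\<close> of \<open>U\<close> and column \<open>k\<close> of \<open>Y\<close> can be read off successively.
\<close>

lemma LDU_unique:
  assumes Y: "Y \<in> lower_unipotent n" "Y' \<in> lower_unipotent n"
    and T: "T \<in> pos_diagonal n" "T' \<in> pos_diagonal n"
    and U: "U \<in> upper_unipotent n" "U' \<in> upper_unipotent n"
    and eq: "Y * T * U = Y' * T' * U'"
  shows "T = T'" "U = U'"
proof -
  have carr: "Y \<in> carrier_mat n n" "Y' \<in> carrier_mat n n" "T \<in> carrier_mat n n" "T' \<in> carrier_mat n n"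
    "U \<in> carrier_mat n n" "U' \<in> carrier_mat n n" "diagonal_mat T" "diagonal_mat T'"
    using assms by (auto simp: lower_unipotent_def upper_unipotent_def pos_diagonal_def)
  let ?S = "\<lambda>Y T U m r s. \<Sum>k<m. (Y :: real mat) $$ (r, k) * (T :: real mat) $$ (k, k) * (U :: real mat) $$ (k, s)"
  have split: "?S Y T U n r s = ?S Y T U k r s + Y $$ (r, k) * T $$ (k, k) * U $$ (k, s)"
    if "Y \<in> lower_unipotent n" "U \<in> upper_unipotent n" "r < n" "s < n" "k \<le> r" "k \<le> s" "k = r \<or> k = s"
    for Y T U :: "real mat" and k r s
  proof -
    have "?S Y T U n r s = ?S Y T U (Suc k) r s"
      using that by (intro sum.mono_neutral_right) (auto simp: lower_unipotent_def upper_unipotent_def)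
    then show ?thesis by simp
  qed
  have entry: "?S Y T U n r s = ?S Y' T' U' n r s" if "r < n" "s < n" for r s
    using that eq index_mult_diag_mult[of Y n T U r s] index_mult_diag_mult[of Y' n T' U' r s] carr by simp
  have main: "T $$ (k, k) = T' $$ (k, k) \<and> (\<forall>r<n. Y $$ (r, k) = Y' $$ (r, k)) \<and> (\<forall>s<n. U $$ (k, s) = U' $$ (k, s))"
    if "k < n" for k
    using that
  proof (induction k rule: less_induct)
    case (less k)
    have prev: "?S Y T U k r s = ?S Y' T' U' k r s" if "r < n" "s < n" for r s
      using less that by (intro sum.cong) auto
    have *: "Y $$ (r, k) * T $$ (k, k) * U $$ (k, s) = Y' $$ (r, k) * T' $$ (k, k) * U' $$ (k, s)"
      if "r < n" "s < n" "k \<le> r" "k \<le> s" "k = r \<or> k = s" for r s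
      using split[of Y U r s k T] split[of Y' U' r s k T'] entry[of r s] prev[of r s] Y U that by simp
    have one: "Y $$ (k, k) = 1" "Y' $$ (k, k) = 1" "U $$ (k, k) = 1" "U' $$ (k, k) = 1"
      using Y U less.prems by (auto simp: lower_unipotent_def upper_unipotent_def)
    have Tk: "T $$ (k, k) = T' $$ (k, k)"
      using *[of k k] less.prems one by simp
    have pos: "T' $$ (k, k) > 0" using T less.prems by (auto simp: pos_diagonal_def)
    have "Y $$ (r, k) = Y' $$ (r, k)" if "r < n" for r
    proof (cases "k \<le> r")
      case True
      then show ?thesis using *[of r k] less.prems one that Tk pos by simp
    next
      case False
      then show ?thesis using Y that less.prems by (auto simp: lower_unipotent_def)
    qed
    moreover have "U $$ (k, s) = U' $$ (k, s)" if "s < n" for s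
    proof (cases "k \<le> s")
      case True
      then show ?thesis using *[of k s] less.prems one that Tk pos by simp
    next
      case False
      then show ?thesis using U that less.prems by (auto simp: upper_unipotent_def)
    qed
    ultimately show ?case using Tk by blast
  qed
  show "T = T'"
    using carr main by (intro eq_matI) (auto simp: diagonal_mat_def, metis)
  show "U = U'"
    using carr main by (intro eq_matI) auto
qed

text \<open>No inverse is formed: column \<open>s\<close> of a product with \<open>R\<close> is
  column \<open>s\<close> of the left factor plus a combination of its earlier columns, so the
  columns are recovered from left to right.\<close>

lemma upper_unipotent_cancel_right:
  assumes "A \<in> carrier_mat m n" "B \<in> carrier_mat m n" and R: "R \<in> upper_unipotent n"
    and eq: "A * R = B * R"
  shows "A = B"
proof -
  have "A $$ (r, s) = B $$ (r, s)" if "r < m" "s < n" for r s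
    using that(2)
  proof (induction s rule: less_induct)
    case (less s)
    have "(C * R) $$ (r, s) = (\<Sum>k<s. C $$ (r, k) * R $$ (k, s)) + C $$ (r, s)"
      if "C \<in> carrier_mat m n" for C
    proof -
      have "(C * R) $$ (r, s) = (\<Sum>k<n. C $$ (r, k) * R $$ (k, s))"
        using that R \<open>r < m\<close> less.prems by (intro index_mult_mat_sum) (auto simp: upper_unipotent_def)
      also have "\<dots> = (\<Sum>k<Suc s. C $$ (r, k) * R $$ (k, s))"
        using R less.prems by (intro sum.mono_neutral_right) (auto simp: upper_unipotent_def)
      also have "\<dots> = (\<Sum>k<s. C $$ (r, k) * R $$ (k, s)) + C $$ (r, s)"
        using R less.prems by (auto simp: upper_unipotent_def)
      finally show ?thesis .
    qed
    from this[OF assms(1)] this[OF assms(2)] show ?case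
      using less eq by simp
  qed
  then show ?thesis using assms by (intro eq_matI) auto
qed

section \<open>Peeling the first-row factor off \<open>Xmat\<close>\<close>

definition block_one :: "nat \<Rightarrow> real mat \<Rightarrow> real mat" where
  "block_one n A = four_block_mat (1\<^sub>m 1) (0\<^sub>m 1 n) (0\<^sub>m n 1) A"

lemma block_one_carrier [simp]: "A \<in> carrier_mat n n \<Longrightarrow> block_one n A \<in> carrier_mat (Suc n) (Suc n)"
  using four_block_carrier_mat[of "1\<^sub>m 1" 1 1 A n n] by (simp add: block_one_def)

lemma block_one_dim [simp]: "dim_row (block_one n A) = Suc (dim_row A)" "dim_col (block_one n A) = Suc (dim_col A)"
  by (simp_all add: block_one_def)

lemma index_block_one:
  assumes "A \<in> carrier_mat n n" "r < Suc n" "s < Suc n"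
  shows "block_one n A $$ (r, s) =
    (if r = 0 \<or> s = 0 then (if r = s then 1 else 0) else A $$ (r - 1, s - 1))"
  using assms by (auto simp: block_one_def)

lemma block_one_one: "block_one n (1\<^sub>m n) = 1\<^sub>m (Suc n)"
  by (rule eq_matI) (auto simp: block_one_def)

lemma block_one_mult:
  assumes "A \<in> carrier_mat n n" "B \<in> carrier_mat n n"
  shows "block_one n (A * B) = block_one n A * block_one n B"
  using assms unfolding block_one_def
  by (subst mult_four_block_mat[of _ 1 1 _ n _ n _ _ 1 _ n]) auto

lemma block_one_inj:
  assumes "A \<in> carrier_mat n n" "B \<in> carrier_mat n n" "block_one n A = block_one n B"
  shows "A = B"
proof (rule eq_matI)
  fix r s assume "r < dim_row B" "s < dim_col B"
  then show "A $$ (r, s) = B $$ (r, s)"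
    using index_block_one[OF assms(1), of "Suc r" "Suc s"] index_block_one[OF assms(2), of "Suc r" "Suc s"]
      assms by simp
qed (use assms in auto)

lemma mat_product_block_one:
  "set As \<subseteq> carrier_mat n n \<Longrightarrow>
    mat_product (Suc n) (map (block_one n) As) = block_one n (mat_product n As)"
  by (induction As) (auto simp: block_one_one block_one_mult mat_product_carrier)

lemma block_one_elementary:
  assumes "1 \<le> a" "1 \<le> b"
  shows "block_one n (1\<^sub>m n + c \<cdot>\<^sub>m matrix_unit n a b) =
    1\<^sub>m (Suc n) + c \<cdot>\<^sub>m matrix_unit (Suc n) (Suc a) (Suc b)"
  using assms by (intro eq_matI) (auto simp: index_block_one matrix_unit_def)

definition shift_params :: "(nat \<times> nat \<Rightarrow> 'a) \<Rightarrow> nat \<times> nat \<Rightarrow> 'a" where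
  "shift_params t = (\<lambda>(i, j). t (Suc i, Suc j))"

lemma shift_params_apply [simp]: "shift_params t (i, j) = t (Suc i, Suc j)"
  by (simp add: shift_params_def)

lemma rev_upt_Suc: "rev [Suc a..<Suc b] = map Suc (rev [a..<b])"
  by (metis map_Suc_upt rev_map)

text \<open>The parameter t(i, j) sits in row n - j + i, which rises by exactly one when n, i and j
  all do. This is the effect of \<open>block_one\<close> on matrix units.\<close>

lemma Rmat_Suc:
  assumes "1 \<le> i"
  shows "Rmat (Suc n) t (Suc i) = block_one n (Rmat n (shift_params t) i)"
proof -
  have "Rmat (Suc n) t (Suc i) = mat_product (Suc n) (map (block_one n)
     (map (\<lambda>j. 1\<^sub>m n + shift_params t (i, j) \<cdot>\<^sub>m matrix_unit n (n - j + i) (n - j + i + 1)) (rev [i + 1..<n + 1])))"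
    unfolding Rmat_def using assms
    by (intro arg_cong[where f="mat_product (Suc n)"])
       (auto simp: rev_upt_Suc[of "Suc i"] block_one_elementary simp del: upt_Suc)
  also have "\<dots> = block_one n (Rmat n (shift_params t) i)"
    unfolding Rmat_def by (rule mat_product_block_one) auto
  finally show ?thesis .
qed

lemma Xmat_Suc:
  "Xmat (Suc n) t = block_one n (Xmat n (shift_params t)) * Rmat (Suc n) t 1"
proof (cases "n = 0")
  case True
  then show ?thesis by (auto simp: Xmat_def Rmat_def block_one_one)
next
  case False
  then have "[1..<Suc n] = 1 # map Suc [1..<n]"
    by (simp add: map_Suc_upt upt_conv_Cons)
  then have "map (Rmat (Suc n) t) (rev [1..<Suc n]) =
      map (block_one n) (map (Rmat n (shift_params t)) (rev [1..<n])) @ [Rmat (Suc n) t 1]"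
    by (auto simp: Rmat_Suc rev_map)
  then have "Xmat (Suc n) t = mat_product (Suc n)
      (map (block_one n) (map (Rmat n (shift_params t)) (rev [1..<n])) @ [Rmat (Suc n) t 1])"
    by (simp only: Xmat_def)
  also have "\<dots> = mat_product (Suc n) (map (block_one n) (map (Rmat n (shift_params t)) (rev [1..<n])))
      * mat_product (Suc n) [Rmat (Suc n) t 1]"
    by (rule mat_product_append) auto
  also have "mat_product (Suc n) (map (block_one n) (map (Rmat n (shift_params t)) (rev [1..<n]))) =
      block_one n (Xmat n (shift_params t))"
    unfolding Xmat_def by (rule mat_product_block_one) auto
  finally show ?thesis by (simp add: right_mult_one_mat[of _ "Suc n" "Suc n"])
qed

text \<open>With superdiagonal entries written as ratios f (c - 1) / f c, products of consecutive
  entries telescope to f r / f s. The factor with c = k + 1 adds a multiple of column k to column k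
  + 1 (counted from 0), so after k factors exactly the columns up to k are filled.\<close>

lemma mat_product_bidiagonal:
  fixes f :: "nat \<Rightarrow> real"
  assumes "k < n" and f: "\<And>c. c < n \<Longrightarrow> f c \<noteq> 0" and "r < n" "s < n"
  shows "mat_product n (map (\<lambda>c. 1\<^sub>m n + (f (c - 1) / f c) \<cdot>\<^sub>m matrix_unit n c (c + 1)) [1..<Suc k]) $$ (r, s) =
    (if r \<le> s \<and> (r = s \<or> s \<le> k) then f r / f s else 0)"
  using assms
proof (induction k arbitrary: r s)
  case 0
  then show ?case by auto
next
  case (Suc k)
  let ?E = "\<lambda>c. 1\<^sub>m n + (f (c - 1) / f c) \<cdot>\<^sub>m matrix_unit n c (c + 1)"
  let ?P = "mat_product n (map ?E [1..<Suc k])"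
  have P: "?P \<in> carrier_mat n n" by (rule mat_product_carrier) auto
  have "mat_product n (map ?E [1..<Suc (Suc k)]) = mat_product n (map ?E [1..<Suc k] @ [?E (Suc k)])"
    by simp
  also have "\<dots> = ?P * mat_product n [?E (Suc k)]"
    by (rule mat_product_append) auto
  also have "\<dots> = ?P * ?E (Suc k)"
    by (simp add: right_mult_one_mat[of _ n n])
  finally have "mat_product n (map ?E [1..<Suc (Suc k)]) $$ (r, s) = (?P * ?E (Suc k)) $$ (r, s)"
    by simp
  also have "\<dots> = (\<Sum>j<n. ?P $$ (r, j) * ?E (Suc k) $$ (j, s))"
    using P Suc.prems by (intro index_mult_mat_sum) auto
  also have "\<dots> = (\<Sum>j<n. (if j = s then ?P $$ (r, s) else 0) +
      (if j = k then (if s = Suc k then ?P $$ (r, k) * (f k / f (Suc k)) else 0) else 0))"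
    using Suc.prems by (intro sum.cong) (auto simp: matrix_unit_def)
  also have "\<dots> = ?P $$ (r, s) + (if s = Suc k then ?P $$ (r, k) * (f k / f (Suc k)) else 0)"
    using Suc.prems by (simp add: sum.distrib)
  also have "\<dots> = (if r \<le> s \<and> (r = s \<or> s \<le> Suc k) then f r / f s else 0)"
    using Suc.prems Suc.IH[of r s] Suc.IH[of r k] f[of k] f[of "Suc k"] by auto
  finally show ?case .
qed

text \<open>In size n + 1 the parameter t(1, j) sits in row n + 2 - j, so row c carries t(1, n + 2 -
  c).\<close>

lemma Rmat_1_entry:
  fixes f :: "nat \<Rightarrow> real"
  assumes f: "\<And>c. c \<le> n \<Longrightarrow> f c \<noteq> 0"
    and t: "\<And>c. 1 \<le> c \<Longrightarrow> c \<le> n \<Longrightarrow> t (1, n + 2 - c) = f (c - 1) / f c"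
    and "r \<le> n" "s \<le> n"
  shows "Rmat (Suc n) t 1 $$ (r, s) = (if r \<le> s then f r / f s else 0)"
proof -
  have "rev [1 + 1..<Suc n + 1] = map (\<lambda>c. n + 2 - c) [1..<Suc n]"
    by (rule nth_equalityI) (auto simp: rev_nth nth_append simp del: upt_Suc)
  then have "map (\<lambda>j. 1\<^sub>m (Suc n) + t (1, j) \<cdot>\<^sub>m matrix_unit (Suc n) (Suc n - j + 1) (Suc n - j + 1 + 1)) (rev [1 + 1..<Suc n + 1])
     = map (\<lambda>c. 1\<^sub>m (Suc n) + (f (c - 1) / f c) \<cdot>\<^sub>m matrix_unit (Suc n) c (c + 1)) [1..<Suc n]"
    using t by (simp add: Suc_diff_le del: upt_Suc)
  then have "Rmat (Suc n) t 1 = mat_product (Suc n)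
     (map (\<lambda>c. 1\<^sub>m (Suc n) + (f (c - 1) / f c) \<cdot>\<^sub>m matrix_unit (Suc n) c (c + 1)) [1..<Suc n])"
    unfolding Rmat_def by (rule arg_cong)
  then show ?thesis
    using mat_product_bidiagonal[of n "Suc n" f r s] assms by (simp del: upt_Suc)
qed

text \<open>The first row of parameters begins at j = 2; the resulting value 1 at k = 1 normalises
  the ratios below.\<close>

definition row_prod :: "(nat \<times> nat \<Rightarrow> real) \<Rightarrow> nat \<Rightarrow> real" where
  "row_prod t k = (\<Prod>j = 2..k. t (1, j))"

lemma row_prod_1 [simp]: "row_prod t (Suc 0) = 1"
  by (simp add: row_prod_def)

lemma row_prod_Suc: "1 \<le> k \<Longrightarrow> row_prod t (Suc k) = row_prod t k * t (1, Suc k)"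
  by (simp add: row_prod_def)

lemma row_prod_pos: "(\<And>ij. ij \<in> pairs n \<Longrightarrow> t ij > 0) \<Longrightarrow> k \<le> n \<Longrightarrow> row_prod t k > 0"
  unfolding row_prod_def by (intro prod_pos) (auto simp: pairs_def)

lemma row_prod_uminus: "1 \<le> k \<Longrightarrow> row_prod (\<lambda>ij. - t ij) k = (-1) ^ (k - 1) * row_prod t k"
  by (simp add: row_prod_def prod_uminus)

lemma Rmat_1_entry_row_prod:
  assumes nz: "\<And>k. k \<le> Suc n \<Longrightarrow> row_prod t k \<noteq> 0" and "r \<le> n" "s \<le> n"
  shows "Rmat (Suc n) t 1 $$ (r, s) =
    (if r \<le> s then row_prod t (Suc n - r) / row_prod t (Suc n - s) else 0)"
proof (rule Rmat_1_entry[where f = "\<lambda>r. row_prod t (Suc n - r)"])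
  fix c assume c: "1 \<le> c" "c \<le> n"
  then have "Suc n - (c - 1) = Suc (Suc n - c)" "n + 2 - c = Suc (Suc n - c)" by auto
  then show "t (1, n + 2 - c) = row_prod t (Suc n - (c - 1)) / row_prod t (Suc n - c)"
    using nz[of "Suc n - c"] c by (simp add: row_prod_Suc)
qed (use assms in auto)

text \<open>The top row of \<open>Xmat\<close> is that of its last factor, because
  \<open>block_one\<close> has top row (1, 0, ..., 0). It determines all ratios of first-row
  products, hence the first row of parameters; that factor is then cancelled and the block treated
  by induction.\<close>

lemma Xmat_inj:
  assumes "\<And>ij. ij \<in> pairs n \<Longrightarrow> t ij > 0" "\<And>ij. ij \<in> pairs n \<Longrightarrow> t' ij > 0"
    and "Xmat n t = Xmat n t'" and "ij \<in> pairs n"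
  shows "t ij = t' ij"
  using assms
proof (induction n arbitrary: t t' ij)
  case 0
  then show ?case by (auto simp: pairs_def)
next
  case (Suc n)
  have rp: "row_prod t k > 0" "row_prod t' k > 0" if "k \<le> Suc n" for k
    using row_prod_pos[OF Suc.prems(1) that] row_prod_pos[OF Suc.prems(2) that] by auto
  have row0: "(block_one n A * R) $$ (0, s) = R $$ (0, s)"
    if "A \<in> carrier_mat n n" "R \<in> carrier_mat (Suc n) (Suc n)" "s \<le> n" for A R s
  proof -
    have "(block_one n A * R) $$ (0, s) = (\<Sum>k<Suc n. block_one n A $$ (0, k) * R $$ (k, s))"
      using that by (intro index_mult_mat_sum) auto
    also have "\<dots> = (\<Sum>k<Suc n. if k = 0 then R $$ (0, s) else 0)"
      using that by (intro sum.cong) (auto simp: index_block_one)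
    finally show ?thesis by simp
  qed
  have "Rmat (Suc n) t 1 $$ (0, s) = Rmat (Suc n) t' 1 $$ (0, s)" if "s \<le> n" for s
    using Suc.prems(3) row0[of "Xmat n (shift_params t)" "Rmat (Suc n) t 1" s]
      row0[of "Xmat n (shift_params t')" "Rmat (Suc n) t' 1" s] that
    by (simp add: Xmat_Suc)
  moreover have "row_prod t k \<noteq> 0" "row_prod t' k \<noteq> 0" if "k \<le> Suc n" for k
    using rp[OF that] by auto
  ultimately have ratio: "row_prod t (Suc n) / row_prod t (Suc n - s) = row_prod t' (Suc n) / row_prod t' (Suc n - s)"
    if "s \<le> n" for s
    using Rmat_1_entry_row_prod[of n t 0 s] Rmat_1_entry_row_prod[of n t' 0 s] that by simp
  \<comment> \<open>In the last column the denominator is \<open>row_prod t 1 = 1\<close>, which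
    fixes the common scale of the ratios.\<close>
  have "row_prod t (Suc n) = row_prod t' (Suc n)"
    using ratio[of n] by simp
  then have eq: "row_prod t (Suc n - s) = row_prod t' (Suc n - s)" if "s \<le> n" for s
    using ratio[OF that] rp[of "Suc n"] rp[of "Suc n - s"] by (simp add: field_simps)
  have eq: "row_prod t k = row_prod t' k" if "1 \<le> k" "k \<le> Suc n" for k
    using that eq[of "Suc n - k"] by simp
  have first: "t (1, j) = t' (1, j)" if "2 \<le> j" "j \<le> Suc n" for j
  proof -
    have "row_prod t (j - 1) * t (1, j) = row_prod t' (j - 1) * t' (1, j)"
      using eq[of j] row_prod_Suc[of "j - 1" t] row_prod_Suc[of "j - 1" t'] that by simp
    moreover have "1 \<le> j - 1" "j - 1 \<le> Suc n" using that by auto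
    ultimately show ?thesis using eq[of "j - 1"] rp[of "j - 1"] by simp
  qed
  have R: "Rmat (Suc n) t 1 = Rmat (Suc n) t' 1"
    unfolding Rmat_def
  proof (rule arg_cong[where f="mat_product (Suc n)"], rule map_cong[OF refl])
    fix j assume "j \<in> set (rev [1 + 1..<Suc n + 1])"
    then have "t (1, j) = t' (1, j)" by (intro first) (auto simp del: upt_Suc)
    then show "1\<^sub>m (Suc n) + t (1, j) \<cdot>\<^sub>m matrix_unit (Suc n) (Suc n - j + 1) (Suc n - j + 1 + 1) =
        1\<^sub>m (Suc n) + t' (1, j) \<cdot>\<^sub>m matrix_unit (Suc n) (Suc n - j + 1) (Suc n - j + 1 + 1)"
      by simp
  qed
  have "block_one n (Xmat n (shift_params t)) = block_one n (Xmat n (shift_params t'))"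
  proof (rule upper_unipotent_cancel_right[where m = "Suc n", OF _ _ Rmat_upper_unipotent])
    show "block_one n (Xmat n (shift_params t)) * Rmat (Suc n) t 1 =
        block_one n (Xmat n (shift_params t')) * Rmat (Suc n) t 1"
      using Suc.prems(3) unfolding Xmat_Suc R .
  qed auto
  then have X: "Xmat n (shift_params t) = Xmat n (shift_params t')"
    by (rule block_one_inj[rotated 2]) auto
  have IH: "shift_params t kl = shift_params t' kl" if "kl \<in> pairs n" for kl
    using that by (intro Suc.IH[OF _ _ X]) (auto simp: pairs_def intro!: Suc.prems)
  obtain i j where ij: "ij = (i, j)" "1 \<le> i" "i < j" "j \<le> Suc n"
    using Suc.prems(4) by (auto simp: pairs_def)
  show ?case
  proof (cases "i = 1")
    case True
    then show ?thesis using ij first[of j] by simp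
  next
    case False
    then have "(i - 1, j - 1) \<in> pairs n" using ij unfolding pairs_def by auto
    then show ?thesis using ij IH[of "(i - 1, j - 1)"] by simp
  qed
qed

section \<open>Moving a diagonal matrix past \<open>Xmat\<close>\<close>

lemma mat_diag_mult_mat_product:
  assumes "\<And>x. x \<in> set xs \<Longrightarrow> A x \<in> carrier_mat n n" "\<And>x. x \<in> set xs \<Longrightarrow> B x \<in> carrier_mat n n"
    and "D \<in> carrier_mat n n" and "\<And>x. x \<in> set xs \<Longrightarrow> D * A x = B x * D"
  shows "D * mat_product n (map A xs) = mat_product n (map B xs) * D"
  using assms
proof (induction xs)
  case Nil
  then show ?case by simp
next
  case (Cons x xs)
  have c: "mat_product n (map A xs) \<in> carrier_mat n n" "mat_product n (map B xs) \<in> carrier_mat n n"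
    using Cons.prems by (auto intro!: mat_product_carrier)
  have "D * (A x * mat_product n (map A xs)) = (D * A x) * mat_product n (map A xs)"
    using Cons.prems c by (intro assoc_mult_mat[symmetric]) auto
  also have "\<dots> = B x * (D * mat_product n (map A xs))"
    using Cons.prems c by (simp add: assoc_mult_mat[of _ n n _ n _ n])
  also have "\<dots> = B x * (mat_product n (map B xs) * D)"
    using Cons by simp
  also have "\<dots> = (B x * mat_product n (map B xs)) * D"
    using Cons.prems c by (intro assoc_mult_mat[symmetric]) auto
  finally show ?case by simp
qed

text \<open>Conjugation by diag(d) multiplies the matrix unit in position (m, m + 1) by d m / d (m +
  1), and t(i, j) has m = n - j + i. This serves both the induction for the left vector and the
  torus action on the right vector.\<close>

lemma mat_diag_mult_Xmat:
  assumes d: "\<And>m. 1 \<le> m \<Longrightarrow> m \<le> n \<Longrightarrow> d m \<noteq> 0"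
    and q: "\<And>i j. (i, j) \<in> pairs n \<Longrightarrow> q (i, j) * d (n - j + i + 1) = d (n - j + i) * t (i, j)"
  shows "mat_diag n (\<lambda>r. d (Suc r)) * Xmat n t = Xmat n q * mat_diag n (\<lambda>r. d (Suc r))"
proof -
  let ?D = "mat_diag n (\<lambda>r. d (Suc r))"
  have elem: "?D * (1\<^sub>m n + u \<cdot>\<^sub>m matrix_unit n m (m + 1)) = (1\<^sub>m n + v \<cdot>\<^sub>m matrix_unit n m (m + 1)) * ?D"
    if "v * d (m + 1) = d m * u" for u v m
    using that by (intro eq_matI)
      (auto simp: mat_diag_mult_left[of _ n n] mat_diag_mult_right[of _ n n] matrix_unit_def)
  have "?D * Rmat n t i = Rmat n q i * ?D" if "1 \<le> i" for i
    unfolding Rmat_def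
  proof (rule mat_diag_mult_mat_product)
    fix j assume "j \<in> set (rev [i + 1..<n + 1])"
    then have "(i, j) \<in> pairs n" using that by (auto simp: pairs_def simp del: upt_Suc)
    from q[OF this] show "?D * (1\<^sub>m n + t (i, j) \<cdot>\<^sub>m matrix_unit n (n - j + i) (n - j + i + 1)) =
        (1\<^sub>m n + q (i, j) \<cdot>\<^sub>m matrix_unit n (n - j + i) (n - j + i + 1)) * ?D"
      by (rule elem)
  qed auto
  then show ?thesis
    unfolding Xmat_def by (intro mat_diag_mult_mat_product) auto
qed

text \<open>
  \<open>dual_params\<close> is the \<open>p\<close> and \<open>torus_part\<close> the diagonal of \<open>T\<close> in \<open>X(-t) w\<^sub>0 = Y T X(p)\<close>.
\<close>

definition dual_params :: "nat \<Rightarrow> (nat \<times> nat \<Rightarrow> real) \<Rightarrow> nat \<times> nat \<Rightarrow> real" where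
  "dual_params n t = (\<lambda>(i, j).
     (\<Prod>m\<in>{1..<i}. t (m, n + i - j)) / (\<Prod>m\<in>{1..i}. t (m, n + 1 + i - j)))"

definition torus_part :: "nat \<Rightarrow> (nat \<times> nat \<Rightarrow> real) \<Rightarrow> nat \<Rightarrow> real" where
  "torus_part n t k = (\<Prod>j\<in>{k+1..n}. t (k, j)) / (\<Prod>m\<in>{1..<k}. t (m, k))"

section \<open>The explicit factorization behind the left vector\<close>

lemma index_w0bar:
  assumes "r < n" "s < n"
  shows "w0bar n $$ (r, s) = (if r + s = n - 1 then (-1) ^ r else 0)"
proof -
  have "w0bar n $$ (r, s) = (\<Sum>k = 1..n. (-1) ^ (k - 1) * matrix_unit n k (n + 1 - k) $$ (r, s))"
    using assms by (simp add: w0bar_def)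
  also have "\<dots> = (\<Sum>k = 1..n. if k = Suc r then (if r + s = n - 1 then (-1) ^ r else 0) else 0)"
    using assms by (intro sum.cong refl) (auto simp: matrix_unit_def)
  also have "\<dots> = (if r + s = n - 1 then (-1) ^ r else 0)"
    using assms by (subst sum.delta) auto
  finally show ?thesis .
qed

lemma w0bar_carrier [simp]: "w0bar n \<in> carrier_mat n n"
  by (simp add: w0bar_def)

lemma dual_params_first_row:
  assumes "2 \<le> c" "c \<le> n"
  shows "dual_params n t (1, n + 2 - c) = inverse (t (1, c))"
proof -
  have "n + 1 + 1 - (n + 2 - c) = c" using assms by simp
  then show ?thesis by (simp add: dual_params_def divide_inverse)
qed

text \<open>
  The quotient \<open>R\<^sub>1(-t) w\<^sub>0 R\<^sub>1(p)\<^sup>-\<^sup>1\<close>: its lower right block is \<open>w\<^sub>0\<close> of size \<open>n\<close> times a diagonal matrix,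
  which is what drives the induction.
\<close>

definition peel_mat :: "nat \<Rightarrow> (nat \<times> nat \<Rightarrow> real) \<Rightarrow> real mat" where
  "peel_mat n t = four_block_mat (row_prod t (Suc n) \<cdot>\<^sub>m 1\<^sub>m 1) (0\<^sub>m 1 n)
     (Matrix.mat n 1 (\<lambda>(r, s). (-1) ^ Suc r * row_prod t (n - r)))
     (w0bar n * mat_diag n (\<lambda>s. inverse (t (1, s + 2))))"

lemma peel_mat_carrier [simp]: "peel_mat n t \<in> carrier_mat (Suc n) (Suc n)"
  by (rule carrier_matI) (simp_all add: peel_mat_def mat_diag_def carrier_matD[OF w0bar_carrier])

lemma index_peel_mat:
  assumes "r \<le> n" "s \<le> n"
  shows "peel_mat n t $$ (r, s) =
    (if r = 0 then (if s = 0 then row_prod t (Suc n) else 0)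
     else if s = 0 then (-1) ^ r * row_prod t (Suc n - r)
     else if r + s = Suc n then (-1) ^ (r - 1) * inverse (t (1, s + 1)) else 0)"
proof (cases "r = 0 \<or> s = 0")
  case True
  then show ?thesis using assms unfolding peel_mat_def
    by (cases r) (auto simp: mat_diag_mult_right[of _ n n])
next
  case False
  then obtain r' s' where rs: "r = Suc r'" "s = Suc s'" by (metis not0_implies_Suc)
  then show ?thesis using assms unfolding peel_mat_def
    by (auto simp: mat_diag_mult_right[of _ n n] index_w0bar)
qed

text \<open>The left side has entries (-1)^r row_prod (n + 1 - r) / row_prod (s + 1) for r + s \<le>
  n and 0 beyond. On the right, column 0 of \<open>peel_mat\<close> against row 0 of the last factor
  produces this expression for every s, and the signed antidiagonal of \<open>peel_mat\<close>
  contributes its negative exactly where r + s > n.\<close>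

lemma Rmat_1_w0bar:
  assumes pos: "\<And>ij. ij \<in> pairs (Suc n) \<Longrightarrow> t ij > 0"
  shows "Rmat (Suc n) (\<lambda>ij. - t ij) 1 * w0bar (Suc n) =
    peel_mat n t * Rmat (Suc n) (dual_params (Suc n) t) 1"
    (is "?A * ?W = ?G * ?B")
proof (rule eq_matI)
  have rp: "row_prod t k > 0" if "k \<le> Suc n" for k
    using row_prod_pos[OF pos that] by simp
  have A: "?A $$ (r, s) = (if r \<le> s then (-1) ^ (n - r) * row_prod t (Suc n - r) / ((-1) ^ (n - s) * row_prod t (Suc n - s)) else 0)"
    if "r \<le> n" "s \<le> n" for r s
  proof -
    have "row_prod (\<lambda>ij. - t ij) k \<noteq> 0" if "k \<le> Suc n" for k
    proof (cases "k = 0")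
      case True
      then show ?thesis by (simp add: row_prod_def)
    next
      case False
      then show ?thesis using rp[OF that] row_prod_uminus[of k t] by simp
    qed
    then show ?thesis
      using that by (subst Rmat_1_entry_row_prod) (auto simp: row_prod_uminus)
  qed
  have B: "?B $$ (r, s) = (if r \<le> s then row_prod t (Suc r) / row_prod t (Suc s) else 0)"
    if "r \<le> n" "s \<le> n" for r s
  \<comment> \<open>The first row of \<open>dual_params\<close> consists of the inverses of that of
    \<open>t\<close> in reverse order, so the row products now increase with the row index.\<close>
  proof (rule Rmat_1_entry[where f = "\<lambda>r. row_prod t (Suc r)"])
    fix c assume c: "c \<le> n" then show "row_prod t (Suc c) \<noteq> 0" using rp[of "Suc c"] by simp
  next
    fix c assume c: "1 \<le> c" "c \<le> n"
    have "dual_params (Suc n) t (1, n + 2 - c) = inverse (t (1, Suc c))"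
      using dual_params_first_row[of "Suc c" "Suc n" t] c by simp
    then show "dual_params (Suc n) t (1, n + 2 - c) = row_prod t (Suc (c - 1)) / row_prod t (Suc c)"
      using c rp[of c] by (simp add: row_prod_Suc divide_inverse)
  qed (use that in auto)
  have GB: "?G * ?B \<in> carrier_mat (Suc n) (Suc n)"
    by (rule mult_carrier_mat[OF peel_mat_carrier Rmat_carrier])
  have AW: "?A * ?W \<in> carrier_mat (Suc n) (Suc n)"
    by (rule mult_carrier_mat[OF Rmat_carrier w0bar_carrier])
  show "dim_row (?A * ?W) = dim_row (?G * ?B)" "dim_col (?A * ?W) = dim_col (?G * ?B)"
    unfolding carrier_matD[OF AW] carrier_matD[OF GB] by (rule refl)+
  fix r s assume "r < dim_row (?G * ?B)" "s < dim_col (?G * ?B)"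
  then have rs: "r \<le> n" "s \<le> n"
    unfolding carrier_matD[OF GB] by simp_all
  have "(?A * ?W) $$ (r, s) = (\<Sum>k<Suc n. ?A $$ (r, k) * ?W $$ (k, s))"
    using rs by (intro index_mult_mat_sum[of _ "Suc n" "Suc n" _ "Suc n"]) auto
  also have "\<dots> = (\<Sum>k<Suc n. if k = n - s then ?A $$ (r, n - s) * (-1) ^ (n - s) else 0)"
    using rs by (intro sum.cong) (auto simp: index_w0bar)
  also have "\<dots> = ?A $$ (r, n - s) * (-1) ^ (n - s)"
    using rs by simp
  also have "\<dots> = (if r + s \<le> n then (-1) ^ r * row_prod t (Suc n - r) / row_prod t (Suc s) else 0)"
  proof (cases "r + s \<le> n")
    case True
    then obtain d where n: "n = r + s + d" by (metis le_Suc_ex)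
    have "(-1::real) ^ (n - r) * (-1) ^ (n - s) = (-1) ^ s * (-1) ^ r"
    proof -
      have "n - r + (n - s) = s + r + 2 * d" using n by simp
      then show ?thesis by (simp only: power_add[symmetric]) (simp add: power_add)
    qed
    moreover have "?A $$ (r, n - s) = (-1) ^ (n - r) * row_prod t (Suc n - r) / ((-1) ^ s * row_prod t (Suc s))"
      using A[of r "n - s"] True rs by (simp add: Suc_diff_diff)
    moreover have "a * x / y * b = (a * b) * x / y" for a b x y :: real
      by simp
    ultimately have "?A $$ (r, n - s) * (-1) ^ (n - s) =
        ((-1) ^ s * (-1) ^ r) * row_prod t (Suc n - r) / ((-1) ^ s * row_prod t (Suc s))"
      by (simp only:)
    then show ?thesis using True by simp
  next
    case False
    then show ?thesis using rs A[of r "n - s"] by simp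
  qed
  also have "\<dots> = (?G * ?B) $$ (r, s)"
  proof -
    have "(?G * ?B) $$ (r, s) = (\<Sum>k<Suc n. ?G $$ (r, k) * ?B $$ (k, s))"
      using rs by (intro index_mult_mat_sum[of _ "Suc n" "Suc n" _ "Suc n"]) auto
    also have "\<dots> = (\<Sum>k<Suc n. (if k = 0 then (-1) ^ r * row_prod t (Suc n - r) * ?B $$ (0, s) else 0) +
        (if k = Suc n - r then (if r = 0 then 0 else (-1) ^ (r - 1) * inverse (t (1, Suc n - r + 1)) * ?B $$ (Suc n - r, s)) else 0))"
    proof (rule sum.cong[OF refl])
      fix k assume k: "k \<in> {..<Suc n}"
      show "?G $$ (r, k) * ?B $$ (k, s) = (if k = 0 then (-1) ^ r * row_prod t (Suc n - r) * ?B $$ (0, s) else 0) +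
        (if k = Suc n - r then (if r = 0 then 0 else (-1) ^ (r - 1) * inverse (t (1, Suc n - r + 1)) * ?B $$ (Suc n - r, s)) else 0)"
      proof (cases "k = 0")
        case True
        moreover have "Suc n - r \<noteq> 0" using rs by simp
        ultimately show ?thesis using rs by (simp add: index_peel_mat)
      next
        case False
        moreover have "r + k = Suc n \<longleftrightarrow> k = Suc n - r" using rs by auto
        ultimately show ?thesis using rs k by (simp add: index_peel_mat)
      qed
    qed
    also have "\<dots> = (-1) ^ r * row_prod t (Suc n - r) * ?B $$ (0, s) +
        (if r = 0 then 0 else (-1) ^ (r - 1) * inverse (t (1, Suc n - r + 1)) * ?B $$ (Suc n - r, s))"
      using rs by (subst sum.distrib) (auto simp: sum.delta)
    also have "\<dots> = (if r + s \<le> n then (-1) ^ r * row_prod t (Suc n - r) / row_prod t (Suc s) else 0)"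
    proof (cases "r = 0")
      case True
      then show ?thesis using rs B[of 0 s] by simp
    next
      case False
      define k where "k = Suc n - r"
      have k: "1 \<le> k" "k \<le> n" "k \<le> s \<longleftrightarrow> \<not> r + s \<le> n"
        using rs False by (auto simp: k_def)
      have prod: "row_prod t (Suc k) = row_prod t k * t (1, k + 1)"
        using row_prod_Suc[OF k(1)] by simp
      have "(1, k + 1) \<in> pairs (Suc n)" using k by (auto simp: pairs_def)
      from pos[OF this] have nz: "t (1, k + 1) \<noteq> 0" by simp
      have B0: "?B $$ (0, s) = 1 / row_prod t (Suc s)"
        using B[of 0 s] rs by simp
      have Bk: "?B $$ (k, s) = (if r + s \<le> n then 0 else row_prod t (Suc k) / row_prod t (Suc s))"
        unfolding B[OF k(2) rs(2)] k(3) by (simp only: if_not_P if_P not_not split: if_split) simp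
      have sign: "(-1 :: real) ^ r = - ((-1) ^ (r - 1))"
        using False by (cases r) simp_all
      show ?thesis
      proof (cases "r + s \<le> n")
        case True
        then show ?thesis using False by (simp only: k_def[symmetric] B0 Bk if_True if_False mult_zero_right add_0_right) simp
      next
        case ns: False
        have cancel: "a * b * (1 / c) + x * inverse y * (b * y / c) = (a + x) * b / c" if "y \<noteq> 0" for a b c x y :: real
          using that by (simp add: divide_inverse algebra_simps)
        have "(-1 :: real) ^ r + (-1) ^ (r - 1) = 0" unfolding sign by (rule add.left_inverse)
        with False ns show ?thesis
          by (simp only: k_def[symmetric] B0 Bk if_False prod cancel[OF nz] mult_zero_left div_0)
      qed
    qed
    finally show ?thesis by simp
  qed
  finally show "(?A * ?W) $$ (r, s) = (?G * ?B) $$ (r, s)" .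
qed

lemma torus_part_1: "torus_part (Suc n) t 1 = row_prod t (Suc n)"
proof -
  have "{1..<1::nat} = {}" by simp
  then show ?thesis
    by (simp only: torus_part_def row_prod_def one_add_one prod.empty div_by_1)
qed

text \<open>In position k + 1 the first row enters only through t(1, k + 1), in the denominator;
  this inverse is the diagonal entry supplied by \<open>peel_mat\<close>.\<close>

lemma torus_part_Suc:
  assumes "1 \<le> k"
  shows "torus_part (Suc n) t (Suc k) = torus_part n (shift_params t) k * inverse (t (1, Suc k))"
proof -
  have "(\<Prod>m\<in>{1..<Suc k}. t (m, Suc k)) = t (1, Suc k) * (\<Prod>m\<in>{1..<k}. t (Suc m, Suc k))"
    using assms by (simp add: prod.atLeast_Suc_lessThan prod.shift_bounds_Suc_ivl del: prod.op_ivl_Suc)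
  moreover have "(\<Prod>j\<in>{Suc k + 1..Suc n}. t (Suc k, j)) = (\<Prod>j\<in>{k + 1..n}. t (Suc k, Suc j))"
    using prod.shift_bounds_cl_Suc_ivl[of "\<lambda>j. t (Suc k, j)" "k + 1" n] by simp
  ultimately show ?thesis by (simp add: torus_part_def divide_inverse)
qed

text \<open>The two extra factors are the effect of conjugating by the diagonal matrix in
  \<open>peel_mat\<close>, at superdiagonal position n - j + i.\<close>

lemma dual_params_Suc:
  assumes "(i, j) \<in> pairs n"
  shows "dual_params (Suc n) t (Suc i, Suc j) =
    dual_params n (shift_params t) (i, j) * t (1, n + i - j + 1) * inverse (t (1, n + i - j + 2))"
proof -
  have ij: "1 \<le> i" "i < j" "j \<le> n" using assms by (auto simp: pairs_def)
  have 1: "(\<Prod>m\<in>{1..<Suc i}. t (m, l)) = t (1, l) * (\<Prod>m\<in>{1..<i}. t (Suc m, l))" for l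
    using ij by (simp add: prod.atLeast_Suc_lessThan prod.shift_bounds_Suc_ivl del: prod.op_ivl_Suc)
  have 2: "(\<Prod>m\<in>{1..Suc i}. t (m, l)) = t (1, l) * (\<Prod>m\<in>{1..i}. t (Suc m, l))" for l
    using ij prod.shift_bounds_cl_Suc_ivl[of "\<lambda>m. t (m, l)" 1 i]
    by (simp add: prod.atLeast_Suc_atMost del: prod.cl_ivl_Suc)
  have 3: "Suc n + Suc i - Suc j = n + i - j + 1" "Suc n + 1 + Suc i - Suc j = n + i - j + 2"
    "n + 1 + i - j = n + i - j + 1" "Suc (n + i - j) = n + i - j + 1"
    "Suc (n + i - j + 1) = n + i - j + 2"
    using ij by auto
  show ?thesis
    unfolding dual_params_def prod.case shift_params_apply 1 2 3 by (simp add: divide_inverse)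
qed

lemma lower_unipotent_four_block:
  assumes Y: "Y \<in> lower_unipotent n" and g: "g \<in> carrier_mat n 1"
  shows "four_block_mat (1\<^sub>m 1) (0\<^sub>m 1 n) g Y \<in> lower_unipotent (Suc n)"
proof -
  have [simp]: "dim_row Y = n" "dim_col Y = n" "dim_row g = n" "dim_col g = 1"
    using assms by (auto simp: lower_unipotent_def)
  let ?M = "four_block_mat (1\<^sub>m 1) (0\<^sub>m 1 n) g Y"
  have carr: "?M \<in> carrier_mat (Suc n) (Suc n)"
    unfolding carrier_mat_def by simp
  have "?M $$ (r, r) = 1" if "r < Suc n" for r
    using that Y by (cases r) (auto simp: lower_unipotent_def)
  moreover have "?M $$ (r, s) = 0" if "r < Suc n" "s < Suc n" "r < s" for r s
    using that Y by (cases r; cases s) (auto simp: lower_unipotent_def)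
  ultimately show ?thesis using carr by (auto simp: lower_unipotent_def)
qed

lemma mat_diag_Suc:
  fixes f :: "nat \<Rightarrow> real"
  shows "mat_diag (Suc n) f = four_block_mat (f 0 \<cdot>\<^sub>m 1\<^sub>m 1) (0\<^sub>m 1 n) (0\<^sub>m n 1) (mat_diag n (\<lambda>r. f (Suc r)))"
proof (rule eq_matI)
  let ?M = "four_block_mat (f 0 \<cdot>\<^sub>m 1\<^sub>m 1) (0\<^sub>m 1 n) (0\<^sub>m n 1) (mat_diag n (\<lambda>r. f (Suc r)))"
  have dim: "dim_row ?M = Suc n" "dim_col ?M = Suc n" by (simp_all add: mat_diag_def)
  then show "dim_row (mat_diag (Suc n) f) = dim_row ?M" "dim_col (mat_diag (Suc n) f) = dim_col ?M"
    by (simp_all only: dim carrier_matD[OF mat_diag_dim])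
  fix r s assume "r < dim_row ?M" "s < dim_col ?M"
  then have "r < Suc n" "s < Suc n" unfolding dim .
  then show "mat_diag (Suc n) f $$ (r, s) = ?M $$ (r, s)"
    by (cases r; cases s) (simp_all add: mat_diag_def)
qed

text \<open>This shape is closed under multiplication and covers every factor of the inductive step
  except the last one, so that step reduces to a corner, a column and a block.\<close>

definition lower_block :: "nat \<Rightarrow> real \<Rightarrow> real mat \<Rightarrow> real mat \<Rightarrow> real mat" where
  "lower_block n a g A = four_block_mat (a \<cdot>\<^sub>m 1\<^sub>m 1) (0\<^sub>m 1 n) g A"

lemma lower_block_mult:
  assumes "g \<in> carrier_mat n 1" "h \<in> carrier_mat n 1" "A \<in> carrier_mat n n" "B \<in> carrier_mat n n"
  shows "lower_block n a g A * lower_block n b h B = lower_block n (a * b) (b \<cdot>\<^sub>m g + A * h) (A * B)"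
proof -
  have g: "g * (b \<cdot>\<^sub>m 1\<^sub>m 1) = b \<cdot>\<^sub>m g"
    using assms(1) mult_smult_distrib[of g n 1 "1\<^sub>m 1" 1 b] right_mult_one_mat[of g n 1] by simp
  have "(a \<cdot>\<^sub>m 1\<^sub>m 1) * (b \<cdot>\<^sub>m 1\<^sub>m 1) + 0\<^sub>m 1 n * h = (a * b) \<cdot>\<^sub>m 1\<^sub>m 1"
    using assms(2) by (intro eq_matI) (auto simp: scalar_prod_def)
  moreover have "(a \<cdot>\<^sub>m 1\<^sub>m 1) * 0\<^sub>m 1 n + 0\<^sub>m 1 n * B = 0\<^sub>m 1 n"
    using assms(4) by (intro eq_matI) (auto simp: scalar_prod_def)
  moreover have "g * 0\<^sub>m 1 n + A * B = A * B"
    using assms by (simp add: right_mult_zero_mat[of g n 1] left_add_zero_mat[of _ n n] mult_carrier_mat[of A n n B n])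
  moreover have "lower_block n a g A * lower_block n b h B = four_block_mat
      ((a \<cdot>\<^sub>m 1\<^sub>m 1) * (b \<cdot>\<^sub>m 1\<^sub>m 1) + 0\<^sub>m 1 n * h) ((a \<cdot>\<^sub>m 1\<^sub>m 1) * 0\<^sub>m 1 n + 0\<^sub>m 1 n * B)
      (g * (b \<cdot>\<^sub>m 1\<^sub>m 1) + A * h) (g * 0\<^sub>m 1 n + A * B)"
    unfolding lower_block_def using assms by (intro mult_four_block_mat[of _ 1 1 _ n _ n _ _ 1 _ n]) auto
  ultimately show ?thesis unfolding g by (simp only: lower_block_def)
qed

lemma block_one_eq_lower_block: "block_one n A = lower_block n 1 (0\<^sub>m n 1) A"
proof -
  have "(1 :: real) \<cdot>\<^sub>m 1\<^sub>m 1 = 1\<^sub>m 1" by (rule eq_matI) auto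
  then show ?thesis by (simp only: block_one_def lower_block_def)
qed

text \<open>Peeling leaves the block X w0 D, where D is diagonal. By induction it is Y T P D, and
  moving D to the left of P gives Y (T D) P', with T D and P' the data of the next size.
  \<open>Y\<close> stays implicit since the Whittaker vectors do not depend on it.\<close>

lemma Xmat_uminus_w0bar_factorization:
  assumes "\<And>ij. ij \<in> pairs n \<Longrightarrow> t ij > 0"
  shows "\<exists>Y\<in>lower_unipotent n. Xmat n (\<lambda>ij. - t ij) * w0bar n =
    Y * mat_diag n (\<lambda>r. torus_part n t (Suc r)) * Xmat n (dual_params n t)"
  using assms
proof (induction n arbitrary: t)
  case 0
  have "1\<^sub>m 0 \<in> lower_unipotent 0" by (auto simp: lower_unipotent_def)
  then show ?case
    using carrier_matD[OF w0bar_carrier[of 0]] carrier_matD[OF Xmat_carrier[of 0]]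
    by (intro bexI[of _ "1\<^sub>m 0"] eq_matI) auto
next
  case (Suc n)
  define u where "u s = inverse (t (1, s + 2))" for s
  define X where "X = Xmat n (\<lambda>ij. - shift_params t ij)"
  define T where "T = mat_diag n (\<lambda>r. torus_part n (shift_params t) (Suc r))"
  define D where "D = mat_diag n u"
  define P where "P = Xmat n (dual_params n (shift_params t))"
  define P' where "P' = Xmat n (shift_params (dual_params (Suc n) t))"
  define R where "R = Rmat (Suc n) (dual_params (Suc n) t) 1"
  define g where "g = Matrix.mat n 1 (\<lambda>(r, s). (-1) ^ Suc r * row_prod t (n - r))"
  define a where "a = row_prod t (Suc n)"
  have "a > 0" unfolding a_def by (rule row_prod_pos[OF Suc.prems]) auto
  have carr [simp]: "X \<in> carrier_mat n n" "T \<in> carrier_mat n n" "D \<in> carrier_mat n n" "P \<in> carrier_mat n n"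
    "P' \<in> carrier_mat n n" "R \<in> carrier_mat (Suc n) (Suc n)" "g \<in> carrier_mat n 1"
    by (simp_all add: X_def T_def D_def P_def P'_def R_def g_def)
  have tpos: "t (1, m) > 0" if "2 \<le> m" "m \<le> Suc n" for m
    using that by (intro Suc.prems) (auto simp: pairs_def)
  have "shift_params t ij > 0" if "ij \<in> pairs n" for ij
    using that by (cases ij) (auto simp: pairs_def intro!: Suc.prems)
  then obtain Y where Y: "Y \<in> lower_unipotent n" and XW: "X * w0bar n = Y * T * P"
    using Suc.IH[of "shift_params t"] unfolding X_def T_def P_def by blast
  have [simp]: "Y \<in> carrier_mat n n" using Y by (simp add: lower_unipotent_def)
  \<comment> \<open>Conjugation by \<open>D\<close> turns the dual parameters of the shifted
    \<open>t\<close> into the shifted dual parameters of \<open>t\<close>.\<close>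
  have PD: "D * P' = P * D"
  proof -
    define d where "d m = u (m - 1)" for m
    have "mat_diag n (\<lambda>r. d (Suc r)) * P' = P * mat_diag n (\<lambda>r. d (Suc r))"
      unfolding P_def P'_def
    proof (rule mat_diag_mult_Xmat)
      fix i j assume ij: "(i, j) \<in> pairs n"
      then have *: "1 \<le> i" "i < j" "j \<le> n" by (auto simp: pairs_def)
      have idx: "n - j + i - 1 + 2 = n + i - j + 1" "n - j + i + 1 - 1 + 2 = n + i - j + 2"
        using * by auto
      have "2 \<le> n + i - j + 1" "n + i - j + 1 \<le> Suc n" using * by auto
      from tpos[OF this] have "t (1, n + i - j + 1) \<noteq> 0" by simp
      then show "dual_params n (shift_params t) (i, j) * d (n - j + i + 1) =
          d (n - j + i) * shift_params (dual_params (Suc n) t) (i, j)"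
        unfolding d_def u_def idx shift_params_apply dual_params_Suc[OF ij] by simp
    next
      fix m assume "1 \<le> m" "m \<le> n"
      then show "d m \<noteq> 0" using tpos[of "m + 1"] by (simp add: d_def u_def)
    qed
    then show ?thesis by (simp add: d_def D_def)
  qed
  have Xg: "X * g \<in> carrier_mat n 1" by (rule mult_carrier_mat[OF carr(1) carr(7)])
  note carr(7)[unfolded One_nat_def, simp] Xg[unfolded One_nat_def, simp]
  \<comment> \<open>The corner \<open>a\<close> belongs to the diagonal factor and multiplies the
    column of \<open>Y'\<close> back, so that column is divided by \<open>a\<close>
    beforehand.\<close>
  define Y' where "Y' = lower_block n 1 (inverse a \<cdot>\<^sub>m (X * g)) Y"
  define T' where "T' = lower_block n a (0\<^sub>m n 1) (T * D)"
  have YT [simp]: "Y * T \<in> carrier_mat n n" by (rule mult_carrier_mat[OF _ carr(2)]) simp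
  have TD [simp]: "T * D \<in> carrier_mat n n" by (rule mult_carrier_mat[OF carr(2,3)])
  have YTD [simp]: "Y * (T * D) \<in> carrier_mat n n" by (rule mult_carrier_mat[OF _ TD]) simp
  have WD [simp]: "w0bar n * D \<in> carrier_mat n n" by (rule mult_carrier_mat[OF w0bar_carrier carr(3)])
  have T': "mat_diag (Suc n) (\<lambda>r. torus_part (Suc n) t (Suc r)) = T'"
  proof -
    have "T * D = mat_diag n (\<lambda>r. torus_part (Suc n) t (Suc (Suc r)))"
      unfolding T_def D_def by (subst mat_diag_mult_right[of _ n n])
        (auto simp: mat_diag_def torus_part_Suc u_def intro!: eq_matI)
    then show ?thesis
      using torus_part_1[of n t] by (simp add: mat_diag_Suc a_def T'_def lower_block_def)
  qed
  have Y': "Y' \<in> lower_unipotent (Suc n)"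
  proof -
    have "(1 :: real) \<cdot>\<^sub>m 1\<^sub>m 1 = 1\<^sub>m 1" by (rule eq_matI) auto
    then show ?thesis
      unfolding Y'_def lower_block_def using lower_unipotent_four_block[OF Y smult_carrier_mat[OF Xg]] by simp
  qed
  have carr' [simp]: "Y' \<in> carrier_mat (Suc n) (Suc n)" "T' \<in> carrier_mat (Suc n) (Suc n)"
    using Y' mat_diag_dim[of "Suc n" "\<lambda>r. torus_part (Suc n) t (Suc r)"] unfolding T'
    by (simp_all add: lower_unipotent_def)
  have peel: "peel_mat n t = lower_block n a g (w0bar n * D)"
    by (simp add: peel_mat_def a_def g_def D_def u_def[abs_def] lower_block_def)
  have XR: "Xmat (Suc n) (\<lambda>ij. - t ij) = block_one n X * Rmat (Suc n) (\<lambda>ij. - t ij) 1"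
  proof -
    have "shift_params (\<lambda>ij. - t ij) = (\<lambda>ij. - shift_params t ij)"
      by (auto simp: shift_params_def fun_eq_iff)
    then show ?thesis unfolding Xmat_Suc X_def by simp
  qed
  have XWD: "X * (w0bar n * D) = Y * (T * D) * P'"
  proof -
    have "X * (w0bar n * D) = X * w0bar n * D"
      by (rule assoc_mult_mat[of _ n n _ n _ n, symmetric]) auto
    also have "\<dots> = Y * T * (P * D)" unfolding XW
      by (rule assoc_mult_mat[of _ n n _ n _ n]) (auto intro: mult_carrier_mat)
    also have "\<dots> = Y * T * (D * P')" unfolding PD ..
    also have "\<dots> = Y * T * D * P'"
      by (rule assoc_mult_mat[of _ n n _ n _ n, symmetric]) (auto intro: mult_carrier_mat)
    finally show ?thesis by (simp add: assoc_mult_mat[of Y n n T n D n])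
  qed
  have "block_one n X * peel_mat n t = lower_block n a (X * g) (X * (w0bar n * D))"
  proof -
    have "a \<cdot>\<^sub>m 0\<^sub>m n 1 + X * g = X * g"
      using carrier_matD[OF Xg] by (intro eq_matI) auto
    moreover have "block_one n X * peel_mat n t = lower_block n (1 * a) (a \<cdot>\<^sub>m 0\<^sub>m n 1 + X * g) (X * (w0bar n * D))"
      unfolding peel block_one_eq_lower_block by (intro lower_block_mult) auto
    ultimately show ?thesis by (simp only: mult_1)
  qed
  also have "\<dots> = Y' * T' * block_one n P'"
  proof -
    have "Y' * T' = lower_block n (1 * a) (a \<cdot>\<^sub>m (inverse a \<cdot>\<^sub>m (X * g)) + Y * 0\<^sub>m n 1) (Y * (T * D))"
      unfolding Y'_def T'_def by (intro lower_block_mult) auto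
    also have "Y * 0\<^sub>m n 1 = 0\<^sub>m n 1" by (rule right_mult_zero_mat) auto
    also have "a \<cdot>\<^sub>m (inverse a \<cdot>\<^sub>m (X * g)) + 0\<^sub>m n 1 = X * g"
      using carrier_matD[OF Xg] \<open>a > 0\<close> by (intro eq_matI) auto
    finally have "Y' * T' = lower_block n a (X * g) (Y * (T * D))" by (simp only: mult_1)
    then have "Y' * T' * block_one n P' =
        lower_block n (a * 1) (1 \<cdot>\<^sub>m (X * g) + Y * (T * D) * 0\<^sub>m n 1) (Y * (T * D) * P')"
      unfolding block_one_eq_lower_block by (simp only:) (intro lower_block_mult, auto)
    also have "Y * (T * D) * 0\<^sub>m n 1 = 0\<^sub>m n 1" by (rule right_mult_zero_mat[OF YTD])
    also have "1 \<cdot>\<^sub>m (X * g) + 0\<^sub>m n 1 = X * g"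
      using carrier_matD[OF Xg] by (intro eq_matI) auto
    finally show ?thesis by (simp only: mult_1_right XWD)
  qed
  finally have peel': "block_one n X * peel_mat n t = Y' * T' * block_one n P'" .
  have "Xmat (Suc n) (\<lambda>ij. - t ij) * w0bar (Suc n) = block_one n X * (Rmat (Suc n) (\<lambda>ij. - t ij) 1 * w0bar (Suc n))"
    unfolding XR by (rule assoc_mult_mat[of _ "Suc n" "Suc n" _ "Suc n" _ "Suc n"]) auto
  also have "\<dots> = block_one n X * (peel_mat n t * R)"
    unfolding R_def by (subst Rmat_1_w0bar[OF Suc.prems]) auto
  also have "\<dots> = block_one n X * peel_mat n t * R"
    by (rule assoc_mult_mat[symmetric, of _ "Suc n" "Suc n" _ "Suc n" _ "Suc n"]) auto
  also have "\<dots> = Y' * T' * (block_one n P' * R)"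
    unfolding peel' by (rule assoc_mult_mat[of _ "Suc n" "Suc n" _ "Suc n" _ "Suc n"])
      (auto intro!: mult_carrier_mat[OF carr'])
  also have "block_one n P' * R = Xmat (Suc n) (dual_params (Suc n) t)"
    unfolding P'_def R_def Xmat_Suc ..
  finally show ?case
    using Y' unfolding T' by (rule bexI)
qed

subsection \<open>The Whittaker vectors\<close>

lemma pos_params_pos: "t \<in> pos_params n \<Longrightarrow> ij \<in> pairs n \<Longrightarrow> t ij > 0"
  by (auto simp: pos_params_def)

lemma pos_params_eqI:
  "t \<in> pos_params n \<Longrightarrow> t' \<in> pos_params n \<Longrightarrow> (\<And>ij. ij \<in> pairs n \<Longrightarrow> t ij = t' ij) \<Longrightarrow> t = t'"
  unfolding pos_params_def by (rule PiE_ext)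

lemma restrict_pos_params:
  "(\<And>ij. ij \<in> pairs n \<Longrightarrow> p ij > 0) \<Longrightarrow> restrict p (pairs n) \<in> pos_params n"
  by (auto simp: pos_params_def)

lemma factorization_unique:
  assumes "Y \<in> lower_unipotent n" "Y' \<in> lower_unipotent n"
    and "T \<in> pos_diagonal n" "T' \<in> pos_diagonal n"
    and "t \<in> pos_params n" "t' \<in> pos_params n"
    and "Y * T * Xmat n t = Y' * T' * Xmat n t'"
  shows "T = T'" "t = t'"
proof -
  note LDU = LDU_unique[OF assms(1-4) Xmat_upper_unipotent Xmat_upper_unipotent assms(7)]
  show "T = T'" by (rule LDU(1))
  show "t = t'"
    by (rule pos_params_eqI[OF assms(5,6)], rule Xmat_inj[OF _ _ LDU(2)])
       (auto intro: pos_params_pos[OF assms(5)] pos_params_pos[OF assms(6)])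
qed

lemma right_whittaker_eval:
  assumes "Y \<in> lower_unipotent n" "T \<in> pos_diagonal n" "t \<in> pos_params n"
  shows "right_whittaker n \<mu> (Y * T * Xmat n t) =
    chi n \<mu> T * complex_of_real (exp (- (\<Sum>ij\<in>pairs n. t ij)))"
  unfolding right_whittaker_def
proof (rule the_equality)
  show "\<exists>Y'\<in>lower_unipotent n. \<exists>T'\<in>pos_diagonal n. \<exists>t'\<in>pos_params n.
      Y * T * Xmat n t = Y' * T' * Xmat n t' \<and>
      chi n \<mu> T * complex_of_real (exp (- (\<Sum>ij\<in>pairs n. t ij))) =
      chi n \<mu> T' * complex_of_real (exp (- (\<Sum>ij\<in>pairs n. t' ij)))"
    using assms by blast
next
  fix v
  assume "\<exists>Y'\<in>lower_unipotent n. \<exists>T'\<in>pos_diagonal n. \<exists>t'\<in>pos_params n.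
      Y * T * Xmat n t = Y' * T' * Xmat n t' \<and>
      v = chi n \<mu> T' * complex_of_real (exp (- (\<Sum>ij\<in>pairs n. t' ij)))"
  then obtain Y' T' t' where *: "Y' \<in> lower_unipotent n" "T' \<in> pos_diagonal n" "t' \<in> pos_params n"
      "Y * T * Xmat n t = Y' * T' * Xmat n t'"
      "v = chi n \<mu> T' * complex_of_real (exp (- (\<Sum>ij\<in>pairs n. t' ij)))"
    by blast
  show "v = chi n \<mu> T * complex_of_real (exp (- (\<Sum>ij\<in>pairs n. t ij)))"
    using factorization_unique[OF assms(1) *(1) assms(2) *(2) assms(3) *(3,4)] *(5) by simp
qed

lemma mat_diag_pos_diagonal: "(\<And>r. r < n \<Longrightarrow> f r > 0) \<Longrightarrow> mat_diag n f \<in> pos_diagonal n"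
  by (simp add: pos_diagonal_def diagonal_mat_def mat_diag_def)

lemma chi_mat_diag: "chi n \<nu> (mat_diag n (\<lambda>r. T (Suc r))) = (\<Prod>k = 1..n. complex_of_real (T k) powr \<nu> k)"
  unfolding chi_def by (intro prod.cong) (auto simp: mat_diag_def)

lemma torus_part_pos:
  assumes "\<And>ij. ij \<in> pairs n \<Longrightarrow> t ij > 0" "k \<le> n" "1 \<le> k"
  shows "torus_part n t k > 0"
  unfolding torus_part_def using assms(2,3)
  by (intro divide_pos_pos prod_pos assms(1)) (auto simp: pairs_def)

lemma dual_params_pos:
  assumes "\<And>ij. ij \<in> pairs n \<Longrightarrow> t ij > 0" "ij \<in> pairs n"
  shows "dual_params n t ij > 0"
proof (cases ij)
  case (Pair i j)
  then have "1 \<le> i" "i < j" "j \<le> n" using assms(2) by (auto simp: pairs_def)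
  then show ?thesis
    unfolding dual_params_def Pair prod.case
    by (intro divide_pos_pos prod_pos assms(1)) (auto simp: pairs_def)
qed

text \<open>The description ranges over the parameters \<open>t\<close> as well, so
  \<open>Xmat_inj\<close> comes in before the uniqueness of the factorization.\<close>

lemma left_whittaker_eval:
  assumes t: "t \<in> pos_params n"
  shows "left_whittaker n \<nu> (Xmat n t) =
    (\<Prod>k = 1..n. complex_of_real (torus_part n t k) powr \<nu> k) *
    complex_of_real (exp (- (\<Sum>ij\<in>pairs n. dual_params n t ij)))"
proof -
  note pos = pos_params_pos[OF t]
  define T where "T = mat_diag n (\<lambda>r. torus_part n t (Suc r))"
  \<comment> \<open>Members of \<open>pos_params\<close> are extensional, whereas the formula for
    \<open>dual_params\<close> has values at all index pairs.\<close>
  define p where "p = restrict (dual_params n t) (pairs n)"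
  have T: "T \<in> pos_diagonal n"
    unfolding T_def by (intro mat_diag_pos_diagonal torus_part_pos[OF pos]) auto
  have p: "p \<in> pos_params n"
    unfolding p_def by (intro restrict_pos_params dual_params_pos[OF pos])
  obtain Y where Y: "Y \<in> lower_unipotent n" "Xmat n (\<lambda>ij. - t ij) * w0bar n = Y * T * Xmat n (dual_params n t)"
    using Xmat_uminus_w0bar_factorization[of n t, OF pos] unfolding T_def by blast
  have "Xmat n (dual_params n t) = Xmat n p" by (rule Xmat_cong) (simp add: p_def)
  with Y(2) have fact: "Xmat n (\<lambda>ij. - t ij) * w0bar n = Y * T * Xmat n p" by simp
  have "left_whittaker n \<nu> (Xmat n t) = chi n \<nu> T * complex_of_real (exp (- (\<Sum>ij\<in>pairs n. p ij)))"
    unfolding left_whittaker_def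
  proof (rule the_equality)
    show "\<exists>t'\<in>pos_params n. Xmat n t = Xmat n t' \<and> (\<exists>Y\<in>lower_unipotent n. \<exists>T'\<in>pos_diagonal n. \<exists>p'\<in>pos_params n.
       Xmat n (\<lambda>ij. - t' ij) * w0bar n = Y * T' * Xmat n p' \<and>
       chi n \<nu> T * complex_of_real (exp (- (\<Sum>ij\<in>pairs n. p ij))) =
       chi n \<nu> T' * complex_of_real (exp (- (\<Sum>ij\<in>pairs n. p' ij))))"
      using t Y(1) T p fact by blast
  next
    fix v
    assume "\<exists>t'\<in>pos_params n. Xmat n t = Xmat n t' \<and> (\<exists>Y\<in>lower_unipotent n. \<exists>T'\<in>pos_diagonal n. \<exists>p'\<in>pos_params n.
       Xmat n (\<lambda>ij. - t' ij) * w0bar n = Y * T' * Xmat n p' \<and>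
       v = chi n \<nu> T' * complex_of_real (exp (- (\<Sum>ij\<in>pairs n. p' ij))))"
    then obtain t' Y' T' p' where *: "t' \<in> pos_params n" "Xmat n t = Xmat n t'"
        "Y' \<in> lower_unipotent n" "T' \<in> pos_diagonal n" "p' \<in> pos_params n"
        "Xmat n (\<lambda>ij. - t' ij) * w0bar n = Y' * T' * Xmat n p'"
        "v = chi n \<nu> T' * complex_of_real (exp (- (\<Sum>ij\<in>pairs n. p' ij)))"
      by blast
    have "t ij = t' ij" if "ij \<in> pairs n" for ij
      by (rule Xmat_inj[of n t t', OF pos pos_params_pos[OF *(1)] *(2) that])
    then have "t = t'" by (rule pos_params_eqI[OF t *(1)])
    then have "Y * T * Xmat n p = Y' * T' * Xmat n p'" using fact *(6) by simp
    from factorization_unique[OF Y(1) *(3) T *(4) p *(5) this]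
    show "v = chi n \<nu> T * complex_of_real (exp (- (\<Sum>ij\<in>pairs n. p ij)))" using *(7) by simp
  qed
  also have "(\<Sum>ij\<in>pairs n. p ij) = (\<Sum>ij\<in>pairs n. dual_params n t ij)"
    by (intro sum.cong) (auto simp: p_def)
  finally show ?thesis unfolding T_def chi_mat_diag .
qed

lemma mat_diag_pow: "mat_diag n f ^\<^sub>m m = mat_diag n (\<lambda>r. f r ^ m :: real)"
proof (induction m)
  case 0
  show ?case by (rule eq_matI) (auto simp: mat_diag_def)
next
  case (Suc m)
  then show ?case by (simp add: mult.commute)
qed

lemma mat_exp_mat_diag: "mat_exp n (mat_diag n f) = mat_diag n (\<lambda>r. exp (f r))"
proof (rule eq_matI)
  fix r s assume "r < dim_row (mat_diag n (\<lambda>r. exp (f r)))" "s < dim_col (mat_diag n (\<lambda>r. exp (f r)))"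
  then have rs: "r < n" "s < n" by (simp_all add: mat_diag_def)
  have "(\<Sum>m. (mat_diag n f ^\<^sub>m m) $$ (r, s) / fact m) = (if r = s then exp (f r) else 0)"
    unfolding mat_diag_pow using rs by (simp add: mat_diag_def exp_def divide_inverse mult.commute)
  then show "mat_exp n (mat_diag n f) $$ (r, s) = mat_diag n (\<lambda>r. exp (f r)) $$ (r, s)"
    using rs by (simp add: mat_exp_def mat_diag_def)
qed (simp_all add: mat_exp_def mat_diag_def)

definition scaled_params :: "nat \<Rightarrow> (nat \<Rightarrow> real) \<Rightarrow> (nat \<times> nat \<Rightarrow> real) \<Rightarrow> nat \<times> nat \<Rightarrow> real" where
  "scaled_params n x t = (\<lambda>(i, j). t (i, j) * exp (x (n - j + i) - x (n - j + i + 1)))"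

text \<open>The torus element is moved to the left of \<open>Xmat\<close>, which rescales the
  parameters; the lower unipotent factor is then the identity.\<close>

lemma right_whittaker_torus_eval:
  assumes t: "t \<in> pos_params n"
  shows "right_whittaker n \<mu> (Xmat n t * mat_exp n (- diag1 n x)) =
    (\<Prod>k = 1..n. complex_of_real (exp (- x k)) powr \<mu> k) *
    complex_of_real (exp (- (\<Sum>ij\<in>pairs n. scaled_params n x t ij)))"
proof -
  note pos = pos_params_pos[OF t]
  define T where "T = mat_diag n (\<lambda>r. exp (- x (Suc r)))"
  define p where "p = restrict (scaled_params n x t) (pairs n)"
  have T: "T \<in> pos_diagonal n" unfolding T_def by (intro mat_diag_pos_diagonal) simp
  have p: "p \<in> pos_params n"
    unfolding p_def scaled_params_def by (intro restrict_pos_params) (auto intro!: mult_pos_pos pos)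
  have one: "1\<^sub>m n \<in> lower_unipotent n" by (simp add: lower_unipotent_def)
  have "- diag1 n x = mat_diag n (\<lambda>r. - x (Suc r))"
    by (rule eq_matI) (auto simp: diag1_def mat_diag_def)
  then have E: "mat_exp n (- diag1 n x) = T"
    by (simp add: mat_exp_mat_diag T_def)
  have "T * Xmat n p = Xmat n t * T"
    unfolding T_def
  proof (rule mat_diag_mult_Xmat)
    fix i j assume "(i, j) \<in> pairs n"
    then show "t (i, j) * exp (- x (n - j + i + 1)) = exp (- x (n - j + i)) * p (i, j)"
      by (simp add: p_def scaled_params_def exp_diff exp_minus field_simps)
  qed simp
  then have "Xmat n t * mat_exp n (- diag1 n x) = 1\<^sub>m n * T * Xmat n p"
    unfolding E by (simp add: T_def left_mult_one_mat[OF mat_diag_dim])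
  then have "right_whittaker n \<mu> (Xmat n t * mat_exp n (- diag1 n x)) =
      chi n \<mu> T * complex_of_real (exp (- (\<Sum>ij\<in>pairs n. p ij)))"
    using right_whittaker_eval[OF one T p] by simp
  also have "(\<Sum>ij\<in>pairs n. p ij) = (\<Sum>ij\<in>pairs n. scaled_params n x t ij)"
    by (intro sum.cong) (auto simp: p_def)
  finally show ?thesis unfolding T_def chi_mat_diag[of n _ "\<lambda>k. exp (- x k)"] .
qed

subsection \<open>The wave function in logarithmic coordinates\<close>

lemma pairs_eq_Sigma: "pairs n = Sigma {1..n} (\<lambda>i. {i+1..n})"
  by (auto simp: pairs_def)

lemma finite_pairs [simp]: "finite (pairs n)"
  by (simp add: pairs_eq_Sigma)

lemma card_pairs: "card (pairs n) = n * (n - 1) div 2"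
proof -
  have "card (pairs n) = (\<Sum>i\<in>{1..n}. card {i+1..n})"
    by (simp add: pairs_eq_Sigma)
  also have "\<dots> = (\<Sum>i\<in>{1..n}. n - i)"
    by simp
  also have "\<dots> = (\<Sum>i<n. i)"
    by (rule sum.reindex_bij_witness[of _ "\<lambda>i. n - i" "\<lambda>i. n - i"]) auto
  also have "\<dots> = n * (n - 1) div 2"
    using Sum_Ico_nat[of 0 n] by (simp add: atLeast0LessThan)
  finally show ?thesis .
qed

lemma sum_pairs_rows:
  "(\<Sum>(i, j)\<in>pairs n. f i j) = (\<Sum>i = 1..n. \<Sum>j\<in>{i+1..n}. f i j)"
  by (simp add: pairs_eq_Sigma sum.Sigma)

lemma sum_pairs_columns:
  "(\<Sum>(i, j)\<in>pairs n. f i j) = (\<Sum>j = 1..n. \<Sum>i\<in>{1..<j}. f i j)"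
proof -
  have "(\<Sum>(i, j)\<in>pairs n. f i j) = (\<Sum>(j, i)\<in>Sigma {1..n} (\<lambda>j. {1..<j}). f i j)"
    by (rule sum.reindex_bij_witness[of _ "\<lambda>(j, i). (i, j)" "\<lambda>(i, j). (j, i)"]) (auto simp: pairs_def)
  then show ?thesis by (simp add: sum.Sigma)
qed

text \<open>
  The matrices, in logarithmic coordinates, of \<open>t \<mapsto> u\<close> and of
  \<open>\<gamma>(i, j) \<mapsto> \<gamma>(i, j) - \<gamma>(i + 1, j + 1)\<close>.
\<close>

definition dual_coeff :: "nat \<times> nat \<Rightarrow> nat \<times> nat \<Rightarrow> real" where
  "dual_coeff = (\<lambda>(k, l) (i, j). of_bool (j + 1 = l \<and> i < k) - of_bool (j = l \<and> i \<le> k))"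

definition shift_coeff :: "nat \<times> nat \<Rightarrow> nat \<times> nat \<Rightarrow> real" where
  "shift_coeff = (\<lambda>(i, j) (k, l). of_bool (k = i \<and> l = j) - of_bool (k = i + 1 \<and> l = j + 1))"

definition linear_map :: "'i set \<Rightarrow> ('i \<Rightarrow> 'i \<Rightarrow> real) \<Rightarrow> ('i \<Rightarrow> real) \<Rightarrow> 'i \<Rightarrow> real" where
  "linear_map I a w i = (\<Sum>j\<in>I. a i j * w j)"

lemma sum_single_pair:
  fixes f :: "nat \<times> nat \<Rightarrow> 'a::comm_monoid_add"
  shows "(\<Sum>(k, l)\<in>pairs n. if k = i \<and> l = j then f (k, l) else 0) = (if (i, j) \<in> pairs n then f (i, j) else 0)"
proof -
  have "(\<Sum>(k, l)\<in>pairs n. if k = i \<and> l = j then f (k, l) else 0) = (\<Sum>kl\<in>pairs n. if kl = (i, j) then f kl else 0)"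
    by (auto simp: case_prod_beta prod_eq_iff intro!: sum.cong)
  then show ?thesis by simp
qed

lemma linear_map_shift_coeff:
  "linear_map (pairs n) shift_coeff y (i, j) = zero_ext n y i j - zero_ext n y (i + 1) (j + 1)"
proof -
  have "linear_map (pairs n) shift_coeff y (i, j) =
      (\<Sum>(k, l)\<in>pairs n. if k = i \<and> l = j then y (k, l) else 0) -
      (\<Sum>(k, l)\<in>pairs n. if k = i + 1 \<and> l = j + 1 then y (k, l) else 0)"
    unfolding linear_map_def sum_subtractf[symmetric]
    by (intro sum.cong) (auto simp: shift_coeff_def)
  then show ?thesis unfolding sum_single_pair by (simp add: zero_ext_def)
qed

lemma linear_map_dual_coeff:
  assumes "(k, l) \<in> pairs n"
  shows "linear_map (pairs n) dual_coeff w (k, l) = (\<Sum>i\<in>{1..<k}. w (i, l - 1)) - (\<Sum>i\<in>{1..k}. w (i, l))"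
proof -
  have kl: "1 \<le> k" "k < l" "l \<le> n" using assms by (auto simp: pairs_def)
  have "linear_map (pairs n) dual_coeff w (k, l) =
      (\<Sum>ij\<in>pairs n. if fst ij < k \<and> snd ij + 1 = l then w ij else 0) -
      (\<Sum>ij\<in>pairs n. if fst ij \<le> k \<and> snd ij = l then w ij else 0)"
    unfolding linear_map_def sum_subtractf[symmetric]
    by (intro sum.cong) (auto simp: dual_coeff_def)
  also have "(\<Sum>ij\<in>pairs n. if fst ij < k \<and> snd ij + 1 = l then w ij else 0) = (\<Sum>ij\<in>{ij \<in> pairs n. fst ij < k \<and> snd ij + 1 = l}. w ij)"
    by (simp add: sum.inter_filter)
  also have "\<dots> = (\<Sum>i\<in>{1..<k}. w (i, l - 1))"
    using kl by (intro sum.reindex_bij_witness[of _ "\<lambda>i. (i, l - 1)" fst]) (auto simp: pairs_def)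
  also have "(\<Sum>ij\<in>pairs n. if fst ij \<le> k \<and> snd ij = l then w ij else 0) = (\<Sum>ij\<in>{ij \<in> pairs n. fst ij \<le> k \<and> snd ij = l}. w ij)"
    by (simp add: sum.inter_filter)
  also have "\<dots> = (\<Sum>i\<in>{1..k}. w (i, l))"
    using kl by (intro sum.reindex_bij_witness[of _ "\<lambda>i. (i, l)" fst]) (auto simp: pairs_def)
  finally show ?thesis .
qed

text \<open>Ranked by the first index: log u(k, l) involves rows below k in column l - 1 and rows up
  to k in column l, so its only variable from a row of index at least k is its own.\<close>

lemma dual_coeff_triangular:
  "\<bar>dual_coeff kl kl\<bar> = 1"
  "kl \<noteq> ij \<Longrightarrow> fst kl \<le> fst ij \<Longrightarrow> dual_coeff kl ij = 0"
  by (auto simp: dual_coeff_def split: prod.splits)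

text \<open>The only other variable has a larger first index, so the rank decreases with it; within
  \<open>pairs n\<close> the subtraction from n is not truncated.\<close>

lemma shift_coeff_triangular:
  "\<bar>shift_coeff ij ij\<bar> = 1"
  "ij \<in> pairs n \<Longrightarrow> kl \<in> pairs n \<Longrightarrow> ij \<noteq> kl \<Longrightarrow> n - fst ij \<le> n - fst kl \<Longrightarrow> shift_coeff ij kl = 0"
  by (auto simp: shift_coeff_def pairs_def split: prod.splits)

text \<open>
  The arguments of the two families of Gamma functions, and the simple root attached to \<open>t(i, j)\<close>.
\<close>

definition gamma_arg1 :: "nat \<Rightarrow> (nat \<Rightarrow> real) \<Rightarrow> (nat \<times> nat \<Rightarrow> complex) \<Rightarrow> nat \<times> nat \<Rightarrow> complex" where
  "gamma_arg1 n lam \<gamma> = (\<lambda>(k, l). zero_ext n \<gamma> k l - zero_ext n \<gamma> (k + 1) l +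
     \<i> * complex_of_real (lam k - lam (n + k - l + 1)))"

definition gamma_arg2 :: "nat \<Rightarrow> (nat \<times> nat \<Rightarrow> complex) \<Rightarrow> nat \<times> nat \<Rightarrow> complex" where
  "gamma_arg2 n \<gamma> = (\<lambda>(k, l). zero_ext n \<gamma> k l - zero_ext n \<gamma> (k + 1) (l + 1))"

definition root_diff :: "nat \<Rightarrow> (nat \<Rightarrow> real) \<Rightarrow> nat \<times> nat \<Rightarrow> real" where
  "root_diff n x = (\<lambda>(i, j). x (n - j + i) - x (n - j + i + 1))"

section \<open>Telescoping of the Gamma arguments\<close>

lemma sum_telescope_column:
  fixes g :: "nat \<Rightarrow> 'a::ab_group_add"
  assumes "i \<le> j"
  shows "(\<Sum>k\<in>{i..<j}. g k - g (k + 1)) = g i - g j"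
  using sum_Suc_diff'[OF assms, of "\<lambda>k. - g k"] by simp

lemma sum_gamma_arg1_column:
  assumes "i \<le> j"
  shows "(\<Sum>k\<in>{i..<j}. gamma_arg1 n lam \<gamma> (k, j)) =
    zero_ext n \<gamma> i j + \<i> * complex_of_real (\<Sum>k\<in>{i..<j}. lam k - lam (n + k - j + 1))"
proof -
  have "(\<Sum>k\<in>{i..<j}. gamma_arg1 n lam \<gamma> (k, j)) =
      (\<Sum>k\<in>{i..<j}. zero_ext n \<gamma> k j - zero_ext n \<gamma> (k + 1) j) +
      (\<Sum>k\<in>{i..<j}. \<i> * complex_of_real (lam k - lam (n + k - j + 1)))"
    by (simp add: gamma_arg1_def sum.distrib del: of_real_diff)
  also have "(\<Sum>k\<in>{i..<j}. zero_ext n \<gamma> k j - zero_ext n \<gamma> (k + 1) j) = zero_ext n \<gamma> i j"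
    using assms by (subst sum_telescope_column) (auto simp: zero_ext_def pairs_def)
  finally show ?thesis by (simp only: sum_distrib_left of_real_sum)
qed

text \<open>log t(i, j) occurs in log u(k, l) along column j from row i on and, with the opposite
  sign, along column j + 1 from row i + 1 on. The gamma parts telescope on each column. The second
  lam index depends only on k - l, so its two contributions cancel and the first ones leave lam j -
  lam i.\<close>

lemma sum_dual_coeff:
  assumes "(i, j) \<in> pairs n"
  shows "(\<Sum>kl\<in>pairs n. gamma_arg1 n lam \<gamma> kl * complex_of_real (dual_coeff kl (i, j))) =
    - (gamma_arg2 n \<gamma> (i, j) + \<i> * complex_of_real (lam i - lam j))"
proof -
  have ij: "1 \<le> i" "i < j" "j \<le> n" using assms by (auto simp: pairs_def)
  let ?\<alpha> = "gamma_arg1 n lam \<gamma>"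
  have "(\<Sum>kl\<in>pairs n. ?\<alpha> kl * complex_of_real (dual_coeff kl (i, j))) =
      (\<Sum>kl\<in>pairs n. if i < fst kl \<and> snd kl = j + 1 then ?\<alpha> kl else 0) -
      (\<Sum>kl\<in>pairs n. if i \<le> fst kl \<and> snd kl = j then ?\<alpha> kl else 0)"
    unfolding sum_subtractf[symmetric] by (intro sum.cong) (auto simp: dual_coeff_def)
  also have "(\<Sum>kl\<in>pairs n. if i \<le> fst kl \<and> snd kl = j then ?\<alpha> kl else 0) =
      (\<Sum>kl\<in>{kl \<in> pairs n. i \<le> fst kl \<and> snd kl = j}. ?\<alpha> kl)"
    by (simp add: sum.inter_filter)
  also have "\<dots> = (\<Sum>k\<in>{i..<j}. ?\<alpha> (k, j))"
    using ij by (intro sum.reindex_bij_witness[of _ "\<lambda>k. (k, j)" fst]) (auto simp: pairs_def)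
  also have "\<dots> = zero_ext n \<gamma> i j + \<i> * complex_of_real (\<Sum>k\<in>{i..<j}. lam k - lam (n + k - j + 1))"
    using ij by (intro sum_gamma_arg1_column) simp
  also have "(\<Sum>kl\<in>pairs n. if i < fst kl \<and> snd kl = j + 1 then ?\<alpha> kl else 0) =
      (\<Sum>kl\<in>{kl \<in> pairs n. i < fst kl \<and> snd kl = j + 1}. ?\<alpha> kl)"
    by (simp add: sum.inter_filter)
  also have "\<dots> = zero_ext n \<gamma> (i + 1) (j + 1) + \<i> * complex_of_real (lam j - lam i +
      (\<Sum>k\<in>{i..<j}. lam k - lam (n + k - j + 1)))"
  \<comment> \<open>Column n + 1 is absent. The formula still holds, because for j = n the sum of
    lam differences telescopes to lam i - lam j.\<close>
  proof (cases "j = n")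
    case True
    then have empty: "{kl \<in> pairs n. i < fst kl \<and> snd kl = j + 1} = {}" by (auto simp: pairs_def)
    have "(\<Sum>k\<in>{i..<j}. lam k - lam (n + k - j + 1)) = lam i - lam j"
      using sum_telescope_column[of i j lam] ij True by simp
    then have zero: "lam j - lam i + (\<Sum>k\<in>{i..<j}. lam k - lam (n + k - j + 1)) = 0" by simp
    show ?thesis unfolding empty zero using True by (simp add: zero_ext_def pairs_def)
  next
    case False
    have "(\<Sum>kl\<in>{kl \<in> pairs n. i < fst kl \<and> snd kl = j + 1}. ?\<alpha> kl) = (\<Sum>k\<in>{i+1..<j+1}. ?\<alpha> (k, j + 1))"
      using ij False by (intro sum.reindex_bij_witness[of _ "\<lambda>k. (k, j + 1)" fst]) (auto simp: pairs_def)
    also have "\<dots> = zero_ext n \<gamma> (i + 1) (j + 1) +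
        \<i> * complex_of_real (\<Sum>k\<in>{i+1..<j+1}. lam k - lam (n + k - (j + 1) + 1))"
      using ij by (intro sum_gamma_arg1_column) simp
    also have "(\<Sum>k\<in>{i+1..<j+1}. lam k - lam (n + k - (j + 1) + 1)) = (\<Sum>k\<in>{i..<j}. lam (k + 1) - lam (n + k - j + 1))"
      by (rule sum.reindex_bij_witness[of _ "\<lambda>k. k + 1" "\<lambda>k. k - 1"]) auto
    also have "\<dots> = (\<Sum>k\<in>{i..<j}. lam k - lam (n + k - j + 1)) - (\<Sum>k\<in>{i..<j}. lam k - lam (k + 1))"
      unfolding sum_subtractf[symmetric] by (intro sum.cong) auto
    also have "\<dots> = lam j - lam i + (\<Sum>k\<in>{i..<j}. lam k - lam (n + k - j + 1))"
      using sum_telescope_column[of i j lam] ij by simp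
    finally show ?thesis .
  qed
  finally show ?thesis by (simp add: gamma_arg2_def algebra_simps)
qed

lemma sum_gamma_arg1_dual:
  "(\<Sum>kl\<in>pairs n. gamma_arg1 n lam \<gamma> kl * complex_of_real (linear_map (pairs n) dual_coeff w kl)) =
   - (\<Sum>ij\<in>pairs n. gamma_arg2 n \<gamma> ij * complex_of_real (w ij)) -
   \<i> * complex_of_real (\<Sum>(i, j)\<in>pairs n. (lam i - lam j) * w (i, j))"
proof -
  have "(\<Sum>kl\<in>pairs n. gamma_arg1 n lam \<gamma> kl * complex_of_real (linear_map (pairs n) dual_coeff w kl)) =
      (\<Sum>kl\<in>pairs n. \<Sum>ij\<in>pairs n. (gamma_arg1 n lam \<gamma> kl * complex_of_real (dual_coeff kl ij)) * complex_of_real (w ij))"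
    by (simp add: linear_map_def sum_distrib_left mult.assoc)
  also have "\<dots> = (\<Sum>ij\<in>pairs n. \<Sum>kl\<in>pairs n. (gamma_arg1 n lam \<gamma> kl * complex_of_real (dual_coeff kl ij)) * complex_of_real (w ij))"
    by (rule sum.swap)
  also have "\<dots> = (\<Sum>ij\<in>pairs n. (\<Sum>kl\<in>pairs n. gamma_arg1 n lam \<gamma> kl * complex_of_real (dual_coeff kl ij)) * complex_of_real (w ij))"
    by (simp only: sum_distrib_right)
  also have "\<dots> = (\<Sum>(i, j)\<in>pairs n. - (gamma_arg2 n \<gamma> (i, j) * complex_of_real (w (i, j))) -
      \<i> * complex_of_real ((lam i - lam j) * w (i, j)))"
  proof (rule sum.cong[OF refl])
    fix ij assume "ij \<in> pairs n"
    then show "(\<Sum>kl\<in>pairs n. gamma_arg1 n lam \<gamma> kl * complex_of_real (dual_coeff kl ij)) * complex_of_real (w ij) =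
        (case ij of (i, j) \<Rightarrow> - (gamma_arg2 n \<gamma> (i, j) * complex_of_real (w (i, j))) -
          \<i> * complex_of_real ((lam i - lam j) * w (i, j)))"
      by (cases ij) (simp add: sum_dual_coeff algebra_simps)
  qed
  also have "\<dots> = - (\<Sum>ij\<in>pairs n. gamma_arg2 n \<gamma> ij * complex_of_real (w ij)) -
     \<i> * complex_of_real (\<Sum>(i, j)\<in>pairs n. (lam i - lam j) * w (i, j))"
    by (simp add: case_prod_beta sum_subtractf sum_negf sum_distrib_left)
  finally show ?thesis .
qed

text \<open>The root depends only on e = j - i. Along each such diagonal the gamma differences
  telescope to the entry (1, 1 + e), the far end being outside \<open>pairs n\<close>; sorting by
  x_k then gives the exponent of the theorem.\<close>

lemma sum_gamma_arg2_root_diff: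
  assumes "n \<ge> 1"
  shows "(\<Sum>k = 1..n. (zero_ext n \<gamma> 1 (n + 2 - k) - zero_ext n \<gamma> 1 (n + 1 - k)) * complex_of_real (x k)) =
    - (\<Sum>ij\<in>pairs n. gamma_arg2 n \<gamma> ij * complex_of_real (root_diff n x ij))"
proof -
  let ?g = "zero_ext n \<gamma>"
  have "(\<Sum>ij\<in>pairs n. gamma_arg2 n \<gamma> ij * complex_of_real (root_diff n x ij)) =
    (\<Sum>(e, i)\<in>Sigma {1..<n} (\<lambda>e. {1..<n-e+1}). (?g i (i + e) - ?g (i + 1) (i + 1 + e)) *
       complex_of_real (x (n - e) - x (n - e + 1)))"
  proof (rule sum.reindex_bij_witness[of _ "\<lambda>(e, i). (i, i + e)" "\<lambda>(i, j). (j - i, i)"])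
    fix ij assume "ij \<in> pairs n"
    then obtain i j where ij: "ij = (i, j)" "1 \<le> i" "i < j" "j \<le> n" by (auto simp: pairs_def)
    then have "n - j + i = n - (j - i)" "i + (j - i) = j" "i + 1 + (j - i) = j + 1" by auto
    then show "(case case ij of (i, j) \<Rightarrow> (j - i, i) of
          (e, i) \<Rightarrow> (?g i (i + e) - ?g (i + 1) (i + 1 + e)) * complex_of_real (x (n - e) - x (n - e + 1))) =
         gamma_arg2 n \<gamma> ij * complex_of_real (root_diff n x ij)"
      unfolding ij(1) by (simp add: gamma_arg2_def root_diff_def)
  qed (auto simp: pairs_def)
  also have "\<dots> = (\<Sum>e\<in>{1..<n}. (\<Sum>i\<in>{1..<n-e+1}. ?g i (i + e) - ?g (i + 1) (i + 1 + e)) *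
       complex_of_real (x (n - e) - x (n - e + 1)))"
    unfolding sum_distrib_right by (rule sum.Sigma[symmetric]) auto
  also have "\<dots> = (\<Sum>e\<in>{1..<n}. ?g 1 (1 + e) * complex_of_real (x (n - e) - x (n - e + 1)))"
  proof (rule sum.cong[OF refl])
    fix e assume e: "e \<in> {1..<n}"
    have "(\<Sum>i\<in>{1..<n-e+1}. ?g i (i + e) - ?g (i + 1) (i + 1 + e)) = ?g 1 (1 + e) - ?g (n - e + 1) (n - e + 1 + e)"
      using e by (intro sum_telescope_column[of 1 "n - e + 1" "\<lambda>i. ?g i (i + e)"]) auto
    also have "?g (n - e + 1) (n - e + 1 + e) = 0"
      using e by (auto simp: zero_ext_def pairs_def)
    finally show "(\<Sum>i\<in>{1..<n-e+1}. ?g i (i + e) - ?g (i + 1) (i + 1 + e)) * complex_of_real (x (n - e) - x (n - e + 1)) =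
        ?g 1 (1 + e) * complex_of_real (x (n - e) - x (n - e + 1))" by simp
  qed
  also have "\<dots> = (\<Sum>e\<in>{1..<n}. ?g 1 (1 + e) * complex_of_real (x (n - e))) -
      (\<Sum>e\<in>{1..<n}. ?g 1 (1 + e) * complex_of_real (x (n - e + 1)))"
    by (simp add: sum_subtractf ring_distribs)
  also have "(\<Sum>e\<in>{1..<n}. ?g 1 (1 + e) * complex_of_real (x (n - e))) =
      (\<Sum>k\<in>{1..<n}. ?g 1 (n + 1 - k) * complex_of_real (x k))"
    by (rule sum.reindex_bij_witness[of _ "\<lambda>k. n - k" "\<lambda>k. n - k"]) (auto simp: Suc_diff_le)
  also have "\<dots> = (\<Sum>k\<in>{1..n}. ?g 1 (n + 1 - k) * complex_of_real (x k))"
    by (rule sum.mono_neutral_left) (auto simp: zero_ext_def pairs_def)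
  also have "(\<Sum>e\<in>{1..<n}. ?g 1 (1 + e) * complex_of_real (x (n - e + 1))) =
      (\<Sum>k\<in>{2..n}. ?g 1 (n + 2 - k) * complex_of_real (x k))"
    by (rule sum.reindex_bij_witness[of _ "\<lambda>k. n + 1 - k" "\<lambda>k. n + 1 - k"]) (auto simp: Suc_diff_le)
  also have "\<dots> = (\<Sum>k\<in>{1..n}. ?g 1 (n + 2 - k) * complex_of_real (x k))"
    by (rule sum.mono_neutral_left) (auto simp: zero_ext_def pairs_def not_le)
  finally show ?thesis by (simp add: sum_subtractf left_diff_distrib)
qed

section \<open>The wave integrand in exponential coordinates\<close>

lemma torus_part_exp:
  assumes "\<And>ij. ij \<in> pairs n \<Longrightarrow> t ij = exp (w ij)" "1 \<le> k" "k \<le> n"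
  shows "torus_part n t k = exp ((\<Sum>j\<in>{k+1..n}. w (k, j)) - (\<Sum>m\<in>{1..<k}. w (m, k)))"
proof -
  have "(\<Prod>j\<in>{k+1..n}. t (k, j)) = (\<Prod>j\<in>{k+1..n}. exp (w (k, j)))"
    using assms(2,3) by (intro prod.cong assms(1)) (auto simp: pairs_def)
  moreover have "(\<Prod>m\<in>{1..<k}. t (m, k)) = (\<Prod>m\<in>{1..<k}. exp (w (m, k)))"
    using assms(2,3) by (intro prod.cong assms(1)) (auto simp: pairs_def)
  ultimately show ?thesis by (simp add: torus_part_def exp_diff exp_sum)
qed

lemma dual_params_exp:
  assumes "\<And>ij. ij \<in> pairs n \<Longrightarrow> t ij = exp (w ij)" and ij: "(i, j) \<in> pairs n"
  shows "dual_params n t (i, j) = exp (linear_map (pairs n) dual_coeff w (i, n + 1 + i - j))"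
proof -
  have *: "1 \<le> i" "i < j" "j \<le> n" using ij by (auto simp: pairs_def)
  have "(\<Prod>m\<in>{1..<i}. t (m, n + i - j)) = (\<Prod>m\<in>{1..<i}. exp (w (m, n + i - j)))"
    using * by (intro prod.cong assms(1)) (auto simp: pairs_def)
  moreover have "(\<Prod>m\<in>{1..i}. t (m, n + 1 + i - j)) = (\<Prod>m\<in>{1..i}. exp (w (m, n + 1 + i - j)))"
    using * by (intro prod.cong assms(1)) (auto simp: pairs_def)
  moreover have "(i, n + 1 + i - j) \<in> pairs n" "n + 1 + i - j - 1 = n + i - j"
    using * by (auto simp: pairs_def)
  ultimately show ?thesis
    by (simp only: dual_params_def prod.case linear_map_dual_coeff exp_diff exp_sum finite_atLeastLessThan finite_atLeastAtMost)
qed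

text \<open>The map (i, j) -> (i, n + 1 + i - j) reverses each row of index pairs, so p and u have
  the same entries in a different order.\<close>

lemma sum_dual_params_exp:
  assumes "\<And>ij. ij \<in> pairs n \<Longrightarrow> t ij = exp (w ij)"
  shows "(\<Sum>ij\<in>pairs n. dual_params n t ij) = (\<Sum>kl\<in>pairs n. exp (linear_map (pairs n) dual_coeff w kl))"
proof (rule sum.reindex_bij_witness[of _ "\<lambda>(i, j). (i, n + 1 + i - j)" "\<lambda>(i, j). (i, n + 1 + i - j)"])
  fix ij assume "ij \<in> pairs n"
  then obtain i j where ij: "ij = (i, j)" "(i, j) \<in> pairs n" by (cases ij) simp
  have "dual_params n t (i, j) = exp (linear_map (pairs n) dual_coeff w (i, n + 1 + i - j))"
    by (rule dual_params_exp[OF assms ij(2)])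
  then show "exp (linear_map (pairs n) dual_coeff w (case ij of (i, j) \<Rightarrow> (i, n + 1 + i - j))) = dual_params n t ij"
    unfolding ij(1) prod.case by (rule sym)
qed (auto simp: pairs_def)

text \<open>Each t(i, j) occurs in the numerator of T_i and in the denominator of T_j, and in no
  other T_k.\<close>

lemma sum_weights_torus:
  fixes a :: "nat \<Rightarrow> 'a::comm_ring_1"
  shows "(\<Sum>k = 1..n. a k * ((\<Sum>j\<in>{k+1..n}. w (k, j)) - (\<Sum>m\<in>{1..<k}. w (m, k)))) =
    (\<Sum>(i, j)\<in>pairs n. (a i - a j) * w (i, j))"
proof -
  have "(\<Sum>k = 1..n. a k * ((\<Sum>j\<in>{k+1..n}. w (k, j)) - (\<Sum>m\<in>{1..<k}. w (m, k)))) =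
     (\<Sum>k = 1..n. \<Sum>j\<in>{k+1..n}. a k * w (k, j)) - (\<Sum>k = 1..n. \<Sum>m\<in>{1..<k}. a k * w (m, k))"
    by (simp only: right_diff_distrib sum_subtractf sum_distrib_left)
  also have "\<dots> = (\<Sum>(i, j)\<in>pairs n. a i * w (i, j)) - (\<Sum>(i, j)\<in>pairs n. a j * w (i, j))"
    using sum_pairs_rows[of "\<lambda>i j. a i * w (i, j)" n] sum_pairs_columns[of "\<lambda>i j. a j * w (i, j)" n] by simp
  also have "\<dots> = (\<Sum>(i, j)\<in>pairs n. (a i - a j) * w (i, j))"
    by (simp add: sum_subtractf[symmetric] case_prod_beta left_diff_distrib)
  finally show ?thesis .
qed

lemma of_real_exp_powr: "complex_of_real (exp a) powr z = exp (z * of_real a)"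
  by (simp add: powr_def Ln_of_real)

definition wave_kernel :: "nat \<Rightarrow> (nat \<Rightarrow> real) \<Rightarrow> (nat \<Rightarrow> real) \<Rightarrow> (nat \<times> nat \<Rightarrow> real) \<Rightarrow> complex" where
  "wave_kernel n lam x w =
    exp (- \<i> * complex_of_real (\<Sum>(i, j)\<in>pairs n. (lam i - lam j) * w (i, j))) *
    (\<Prod>kl\<in>pairs n. complex_of_real (exp (- exp (linear_map (pairs n) dual_coeff w kl)))) *
    (\<Prod>ij\<in>pairs n. complex_of_real (exp (- exp (w ij + root_diff n x ij))))"

text \<open>Both real weights cancel. Since rho_i - rho_j = j - i, the conjugated left character
  contributes t(i, j)^(-(j - i)), which removes the power in the measure; the prefactor exp (-(rho,
  x)) removes the real part of the right character at exp (- h(x)). Only imaginary powers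
  survive.\<close>

lemma wave_integrand_eq:
  assumes t: "t \<in> pos_params n" and w: "\<And>ij. ij \<in> pairs n \<Longrightarrow> w ij = ln (t ij)"
  shows "complex_of_real (exp (- (\<Sum>k = 1..n. rho n k * x k))) * wave_integrand n lam x t =
    exp (- \<i> * complex_of_real (\<Sum>k = 1..n. lam k * x k)) *
    (complex_of_real (\<Prod>ij\<in>pairs n. 1 / t ij) * wave_kernel n lam x w)"
proof -
  define \<mu> where "\<mu> k = \<i> * complex_of_real (lam k) - complex_of_real (rho n k)" for k
  define logT where "logT k = (\<Sum>j\<in>{k+1..n}. w (k, j)) - (\<Sum>m\<in>{1..<k}. w (m, k))" for k
  have tw: "t ij = exp (w ij)" if "ij \<in> pairs n" for ij
    using pos_params_pos[OF t that] w[OF that] by simp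
  let ?A = "\<Sum>kl\<in>pairs n. exp (linear_map (pairs n) dual_coeff w kl)"
  let ?B = "\<Sum>ij\<in>pairs n. exp (w ij + root_diff n x ij)"
  let ?l = "\<Sum>(i, j)\<in>pairs n. (lam i - lam j) * w (i, j)"
  let ?d = "\<Sum>(i, j)\<in>pairs n. real (j - i) * w (i, j)"
  have "(\<Sum>k = 1..n. cnj (\<mu> k) * complex_of_real (logT k)) =
      (\<Sum>(i, j)\<in>pairs n. (cnj (\<mu> i) - cnj (\<mu> j)) * complex_of_real (w (i, j)))"
    using sum_weights_torus[of "\<lambda>k. cnj (\<mu> k)" "\<lambda>ij. complex_of_real (w ij)" n]
    by (simp add: logT_def)
  also have "\<dots> = (\<Sum>(i, j)\<in>pairs n. - \<i> * complex_of_real ((lam i - lam j) * w (i, j)) -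
      complex_of_real (real (j - i) * w (i, j)))"
  proof (rule sum.cong[OF refl])
    fix ij assume "ij \<in> pairs n"
    then obtain i j where ij: "ij = (i, j)" "i < j" by (auto simp: pairs_def)
    have diff: "cnj (\<mu> i) - cnj (\<mu> j) = - \<i> * complex_of_real (lam i - lam j) - complex_of_real (real (j - i))"
      using ij(2) by (simp add: \<mu>_def rho_def of_nat_diff algebra_simps)
    show "(case ij of (i, j) \<Rightarrow> (cnj (\<mu> i) - cnj (\<mu> j)) * complex_of_real (w (i, j))) =
        (case ij of (i, j) \<Rightarrow> - \<i> * complex_of_real ((lam i - lam j) * w (i, j)) -
      complex_of_real (real (j - i) * w (i, j)))"
      unfolding ij(1) prod.case diff by (simp add: algebra_simps)
  qed
  also have "\<dots> = - \<i> * complex_of_real ?l - complex_of_real ?d"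
    by (simp only: case_prod_unfold sum_subtractf sum_distrib_left of_real_sum)
  finally have expo: "(\<Sum>k = 1..n. cnj (\<mu> k) * complex_of_real (logT k)) = - \<i> * complex_of_real ?l - complex_of_real ?d" .
  have left: "cnj (left_whittaker n \<mu> (Xmat n t)) =
      exp (- \<i> * complex_of_real ?l - complex_of_real ?d) * complex_of_real (exp (- ?A))"
  proof -
    have "(\<Prod>k = 1..n. complex_of_real (torus_part n t k) powr \<mu> k) = (\<Prod>k = 1..n. exp (\<mu> k * complex_of_real (logT k)))"
      by (intro prod.cong refl) (simp add: torus_part_exp[of n t w, OF tw] of_real_exp_powr logT_def)
    then have "cnj (\<Prod>k = 1..n. complex_of_real (torus_part n t k) powr \<mu> k) = (\<Prod>k = 1..n. exp (cnj (\<mu> k) * complex_of_real (logT k)))"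
      by (simp add: exp_cnj)
    also have "\<dots> = exp (\<Sum>k = 1..n. cnj (\<mu> k) * complex_of_real (logT k))"
      by (simp add: exp_sum)
    finally have "cnj (\<Prod>k = 1..n. complex_of_real (torus_part n t k) powr \<mu> k) =
        exp (- \<i> * complex_of_real ?l - complex_of_real ?d)"
      unfolding expo .
    moreover have "(\<Sum>ij\<in>pairs n. dual_params n t ij) = ?A"
      by (rule sum_dual_params_exp) (rule tw)
    ultimately show ?thesis
      by (simp only: left_whittaker_eval[OF t] complex_cnj_mult complex_cnj_complex_of_real)
  qed
  have right: "right_whittaker n \<mu> (Xmat n t * mat_exp n (- diag1 n x)) =
      exp (\<Sum>k = 1..n. \<mu> k * complex_of_real (- x k)) * complex_of_real (exp (- ?B))"
  proof -
    have "(\<Sum>ij\<in>pairs n. scaled_params n x t ij) = ?B"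
      by (intro sum.cong) (auto simp: scaled_params_def root_diff_def tw exp_add)
    then show ?thesis
      unfolding right_whittaker_torus_eval[OF t] of_real_exp_powr by (simp add: exp_sum)
  qed
  have jac: "(\<Prod>(i, j)\<in>pairs n. t (i, j) ^ (j - i) / t (i, j)) = exp ?d * (\<Prod>ij\<in>pairs n. 1 / t ij)"
  proof -
    have "exp ?d = (\<Prod>(i, j)\<in>pairs n. t (i, j) ^ (j - i))"
      by (simp add: exp_sum case_prod_beta tw exp_of_nat_mult)
    then show ?thesis by (simp add: case_prod_beta prod.distrib[symmetric])
  qed
  have kernel: "wave_kernel n lam x w = exp (- \<i> * complex_of_real ?l) * complex_of_real (exp (- ?A)) * complex_of_real (exp (- ?B))"
    unfolding wave_kernel_def by (simp only: of_real_prod[symmetric] exp_sum[OF finite_pairs, symmetric] sum_negf)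
  have rho: "complex_of_real (exp (- (\<Sum>k = 1..n. rho n k * x k))) * exp (\<Sum>k = 1..n. \<mu> k * complex_of_real (- x k)) =
      exp (- \<i> * complex_of_real (\<Sum>k = 1..n. lam k * x k))"
  proof -
    have "(\<Sum>k = 1..n. \<mu> k * complex_of_real (- x k)) =
        - \<i> * complex_of_real (\<Sum>k = 1..n. lam k * x k) + complex_of_real (\<Sum>k = 1..n. rho n k * x k)"
      unfolding of_real_sum sum_distrib_left sum.distrib[symmetric]
      by (intro sum.cong) (auto simp: \<mu>_def algebra_simps)
    moreover have "- a + (b + a) = b" for a b :: complex by simp
    ultimately show ?thesis
      by (simp only: exp_of_real[symmetric] of_real_minus exp_add[symmetric])
  qed
  have ld: "exp (- \<i> * complex_of_real ?l - complex_of_real ?d) * complex_of_real (exp ?d) = exp (- \<i> * complex_of_real ?l)"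
    by (simp only: exp_of_real[symmetric] exp_add[symmetric] diff_add_cancel)
  have integrand: "wave_integrand n lam x t = cnj (left_whittaker n \<mu> (Xmat n t)) *
      right_whittaker n \<mu> (Xmat n t * mat_exp n (- diag1 n x)) *
      complex_of_real (\<Prod>(i, j)\<in>pairs n. t (i, j) ^ (j - i) / t (i, j))"
    unfolding wave_integrand_def Let_def \<mu>_def ..
  have regroup: "R * (E * a * (S * b) * (D * J)) = L * (J * (G * a * b))"
    if "R * S = L" "E * D = G" for R E a S b D J L G :: complex
    unfolding that[symmetric] by (simp only: mult_ac)
  show ?thesis
    unfolding integrand left right jac kernel of_real_mult by (rule regroup[OF rho ld])
qed

section \<open>The two families of one-dimensional integrals and their joint kernel\<close>

lemma zero_ext_on_vertical:
  "zero_ext n (on_vertical c y) k l =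
    complex_of_real (zero_ext n c k l) + \<i> * complex_of_real (zero_ext n y k l)"
  by (simp add: zero_ext_def on_vertical_def)

lemma gamma_arg2_on_vertical:
  "gamma_arg2 n (on_vertical c y) ij =
    complex_of_real (linear_map (pairs n) shift_coeff c ij) + \<i> * complex_of_real (linear_map (pairs n) shift_coeff y ij)"
  by (cases ij) (simp add: gamma_arg2_def zero_ext_on_vertical linear_map_shift_coeff algebra_simps)

lemma Re_gamma_arg1_on_vertical:
  "Re (gamma_arg1 n lam (on_vertical c y) (k, l)) = zero_ext n c k l - zero_ext n c (k + 1) l"
  by (simp add: gamma_arg1_def zero_ext_on_vertical)

lemma mellin_barnes_integrand_eq:
  assumes "n \<ge> 1"
  shows "mellin_barnes_integrand n lam x \<gamma> =
    (\<Prod>ij\<in>pairs n. Gamma (gamma_arg2 n \<gamma> ij) * exp (- (gamma_arg2 n \<gamma> ij * complex_of_real (root_diff n x ij)))) *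
    (\<Prod>kl\<in>pairs n. Gamma (gamma_arg1 n lam \<gamma> kl))"
  unfolding mellin_barnes_integrand_def Let_def sum_gamma_arg2_root_diff[OF assms]
  by (simp add: gamma_arg1_def gamma_arg2_def case_prod_unfold prod.distrib exp_sum sum_negf[symmetric]
      del: of_real_diff)

text \<open>In the variables z = log u the integrand is a product of one-variable Gamma integrands,
  and w -> z preserves Lebesgue measure.\<close>

lemma has_bochner_integral_dual_exp:
  assumes "\<And>kl. kl \<in> pairs n \<Longrightarrow> Re (\<alpha> kl) > 0"
  shows "has_bochner_integral (PiM (pairs n) (\<lambda>_. lborel))
    (\<lambda>w. \<Prod>kl\<in>pairs n. exp (\<alpha> kl * complex_of_real (linear_map (pairs n) dual_coeff w kl) -
       complex_of_real (exp (linear_map (pairs n) dual_coeff w kl))))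
    (\<Prod>kl\<in>pairs n. Gamma (\<alpha> kl))"
proof -
  have "has_bochner_integral (PiM (pairs n) (\<lambda>_. lborel))
    (\<lambda>z. \<Prod>kl\<in>pairs n. exp (\<alpha> kl * complex_of_real (z kl) - complex_of_real (exp (z kl))))
    (\<Prod>kl\<in>pairs n. Gamma (\<alpha> kl))"
    by (rule has_bochner_integral_PiM_prod[OF finite_pairs]) (rule Gamma_log_has_bochner_integral[OF assms])
  from has_bochner_integral_triangular[where a = dual_coeff and r = fst, OF finite_pairs _ _ this]
  show ?thesis
    by (simp add: dual_coeff_triangular linear_map_def)
qed

text \<open>The differences gamma(i, j) - gamma(i + 1, j + 1) run independently over vertical lines,
  and their imaginary parts depend on y through a measure-preserving map.\<close>

lemma has_bochner_integral_mellin_barnes_shift: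
  assumes "\<And>ij. ij \<in> pairs n \<Longrightarrow> linear_map (pairs n) shift_coeff c ij > 0"
  shows "has_bochner_integral (PiM (pairs n) (\<lambda>_. lborel))
    (\<lambda>y. \<Prod>ij\<in>pairs n. Gamma (gamma_arg2 n (on_vertical c y) ij) *
       exp (- (gamma_arg2 n (on_vertical c y) ij * complex_of_real (v ij))))
    (\<Prod>ij\<in>pairs n. complex_of_real (2 * pi * exp (- exp (v ij))))"
proof -
  let ?d = "linear_map (pairs n) shift_coeff c"
  have "has_bochner_integral (PiM (pairs n) (\<lambda>_. lborel))
    (\<lambda>y. \<Prod>ij\<in>pairs n. Gamma (complex_of_real (?d ij) + \<i> * complex_of_real (y ij)) *
       exp (- ((complex_of_real (?d ij) + \<i> * complex_of_real (y ij)) * complex_of_real (v ij))))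
    (\<Prod>ij\<in>pairs n. complex_of_real (2 * pi * exp (- exp (v ij))))"
    by (rule has_bochner_integral_PiM_prod[OF finite_pairs]) (rule mellin_barnes_exp[OF assms])
  from has_bochner_integral_triangular[where a = shift_coeff and r = "\<lambda>ij. n - fst ij", OF finite_pairs _ _ this]
  show ?thesis
    by (simp add: shift_coeff_triangular gamma_arg2_on_vertical linear_map_def)
qed

text \<open>The double integrand, written so that the first product is free of \<open>w\<close> and
  the second integrates over \<open>w\<close> to Gamma functions.\<close>

definition joint_kernel ::
    "nat \<Rightarrow> (nat \<Rightarrow> real) \<Rightarrow> (nat \<Rightarrow> real) \<Rightarrow> (nat \<times> nat \<Rightarrow> complex) \<Rightarrow> (nat \<times> nat \<Rightarrow> real) \<Rightarrow> complex" where
  "joint_kernel n lam x \<gamma> w =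
    (\<Prod>ij\<in>pairs n. Gamma (gamma_arg2 n \<gamma> ij) * exp (- (gamma_arg2 n \<gamma> ij * complex_of_real (root_diff n x ij)))) *
    (\<Prod>kl\<in>pairs n. exp (gamma_arg1 n lam \<gamma> kl * complex_of_real (linear_map (pairs n) dual_coeff w kl) -
       complex_of_real (exp (linear_map (pairs n) dual_coeff w kl))))"

text \<open>The same kernel arranged for the integral over gamma: by
  \<open>sum_gamma_arg1_dual\<close>, all dependence on gamma is gathered in Mellin-Barnes
  integrands at the points w + root.\<close>

lemma joint_kernel_eq:
  "joint_kernel n lam x \<gamma> w =
    exp (- \<i> * complex_of_real (\<Sum>(i, j)\<in>pairs n. (lam i - lam j) * w (i, j))) *
    (\<Prod>kl\<in>pairs n. complex_of_real (exp (- exp (linear_map (pairs n) dual_coeff w kl)))) *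
    (\<Prod>ij\<in>pairs n. Gamma (gamma_arg2 n \<gamma> ij) *
       exp (- (gamma_arg2 n \<gamma> ij * complex_of_real (w ij + root_diff n x ij))))"
proof -
  let ?L = "linear_map (pairs n) dual_coeff w" and ?s = "gamma_arg2 n \<gamma>"
  let ?l = "\<Sum>(i, j)\<in>pairs n. (lam i - lam j) * w (i, j)"
  have "(\<Prod>kl\<in>pairs n. exp (gamma_arg1 n lam \<gamma> kl * complex_of_real (?L kl) - complex_of_real (exp (?L kl)))) =
      exp (\<Sum>kl\<in>pairs n. gamma_arg1 n lam \<gamma> kl * complex_of_real (?L kl)) *
      (\<Prod>kl\<in>pairs n. exp (- complex_of_real (exp (?L kl))))"
    by (simp only: exp_sum[OF finite_pairs] prod.distrib[symmetric] exp_add[symmetric] add_uminus_conv_diff)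
  also have "exp (\<Sum>kl\<in>pairs n. gamma_arg1 n lam \<gamma> kl * complex_of_real (?L kl)) =
      (\<Prod>ij\<in>pairs n. exp (- (?s ij * complex_of_real (w ij)))) * exp (- \<i> * complex_of_real ?l)"
    unfolding sum_gamma_arg1_dual
    by (simp only: exp_sum[OF finite_pairs, symmetric] exp_add[symmetric] sum_negf mult_minus_left diff_conv_add_uminus)
  also have "(\<Prod>kl\<in>pairs n. exp (- complex_of_real (exp (?L kl)))) = (\<Prod>kl\<in>pairs n. complex_of_real (exp (- exp (?L kl))))"
    by (simp add: exp_of_real[symmetric])
  finally have "joint_kernel n lam x \<gamma> w = exp (- \<i> * complex_of_real ?l) *
      (\<Prod>kl\<in>pairs n. complex_of_real (exp (- exp (?L kl)))) *
      ((\<Prod>ij\<in>pairs n. Gamma (?s ij) * exp (- (?s ij * complex_of_real (root_diff n x ij)))) *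
       (\<Prod>ij\<in>pairs n. exp (- (?s ij * complex_of_real (w ij)))))"
    unfolding joint_kernel_def by (simp only: mult_ac)
  also have "(\<Prod>ij\<in>pairs n. Gamma (?s ij) * exp (- (?s ij * complex_of_real (root_diff n x ij)))) *
       (\<Prod>ij\<in>pairs n. exp (- (?s ij * complex_of_real (w ij)))) =
      (\<Prod>ij\<in>pairs n. Gamma (?s ij) * exp (- (?s ij * complex_of_real (w ij + root_diff n x ij))))"
    unfolding prod.distrib[symmetric]
    by (intro prod.cong refl) (simp add: algebra_simps flip: exp_add)
  finally show ?thesis .
qed

lemma measurable_zero_ext_on_vertical [measurable]:
  "(\<lambda>y. zero_ext n (on_vertical c y) k l) \<in> borel_measurable (PiM (pairs n) (\<lambda>_. lborel))"
  by (cases "(k, l) \<in> pairs n") (simp_all add: zero_ext_def on_vertical_def)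

lemma measurable_gamma_arg1_on_vertical [measurable]:
  "(\<lambda>y. gamma_arg1 n lam (on_vertical c y) kl) \<in> borel_measurable (PiM (pairs n) (\<lambda>_. lborel))"
  unfolding gamma_arg1_def by (cases kl) simp

lemma measurable_linear_map [measurable]:
  "(\<lambda>w. linear_map I a w i) \<in> borel_measurable (PiM I (\<lambda>_. lborel))"
  unfolding linear_map_def by measurable

lemma has_bochner_integral_joint_kernel_w:
  assumes "n \<ge> 1" and "\<And>kl. kl \<in> pairs n \<Longrightarrow> Re (gamma_arg1 n lam \<gamma> kl) > 0"
  shows "has_bochner_integral (PiM (pairs n) (\<lambda>_. lborel)) (joint_kernel n lam x \<gamma>)
    (mellin_barnes_integrand n lam x \<gamma>)"
  unfolding joint_kernel_def[abs_def] mellin_barnes_integrand_eq[OF assms(1)]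
  by (rule has_bochner_integral_mult_right) (rule has_bochner_integral_dual_exp[OF assms(2)])

lemma has_bochner_integral_joint_kernel_y:
  assumes "\<And>ij. ij \<in> pairs n \<Longrightarrow> linear_map (pairs n) shift_coeff c ij > 0"
  shows "has_bochner_integral (PiM (pairs n) (\<lambda>_. lborel)) (\<lambda>y. joint_kernel n lam x (on_vertical c y) w)
    (complex_of_real ((2 * pi) ^ card (pairs n)) * wave_kernel n lam x w)"
proof -
  let ?E = "exp (- \<i> * complex_of_real (\<Sum>(i, j)\<in>pairs n. (lam i - lam j) * w (i, j))) *
    (\<Prod>kl\<in>pairs n. complex_of_real (exp (- exp (linear_map (pairs n) dual_coeff w kl))))"
  have "has_bochner_integral (PiM (pairs n) (\<lambda>_. lborel)) (\<lambda>y. joint_kernel n lam x (on_vertical c y) w)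
     (?E * (\<Prod>ij\<in>pairs n. complex_of_real (2 * pi * exp (- exp (w ij + root_diff n x ij)))))"
    unfolding joint_kernel_eq
    by (rule has_bochner_integral_mult_right) (rule has_bochner_integral_mellin_barnes_shift[OF assms])
  also have "?E * (\<Prod>ij\<in>pairs n. complex_of_real (2 * pi * exp (- exp (w ij + root_diff n x ij)))) =
      complex_of_real ((2 * pi) ^ card (pairs n)) * wave_kernel n lam x w"
    by (simp add: wave_kernel_def prod.distrib)
  finally show ?thesis .
qed

theorem theorem3p2:
  fixes n d :: nat and lam x :: "nat \<Rightarrow> real" and c :: "nat \<times> nat \<Rightarrow> real"
  assumes "n \<ge> 2"
    and "d = n * (n - 1) div 2"
    and "\<And>k l. (k, l) \<in> pairs n \<Longrightarrow> zero_ext n c k l > zero_ext n c (k + 1) l"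
    and "\<And>k l. (k, l) \<in> pairs n \<Longrightarrow> zero_ext n c k l > zero_ext n c (k + 1) (l + 1)"
  shows "set_integrable (PiM (pairs n) (\<lambda>_. lborel)) (pos_params n) (wave_integrand n lam x) \<and>
    vertical_integrable (pairs n) c (mellin_barnes_integrand n lam x) \<and>
    wave_function n lam x =
      exp (- \<i> * complex_of_real (\<Sum>k = 1..n. lam k * x k)) / (2 * complex_of_real pi * \<i>) ^ d *
      vertical_integral (pairs n) c (mellin_barnes_integrand n lam x)"
proof -
  let ?M = "PiM (pairs n) (\<lambda>_. lborel :: real measure)"
  have d: "card (pairs n) = d" using assms(2) by (simp add: card_pairs)
  have n: "n \<ge> 1" using assms(1) by simp
  define F where "F w y = joint_kernel n lam x (on_vertical c y) w" for w y
  define MB where "MB y = mellin_barnes_integrand n lam x (on_vertical c y)" for y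
  \<comment> \<open>The two conditions on \<open>c\<close> say that the real parts of the two
    families of Gamma arguments are positive.\<close>
  have pos1: "Re (gamma_arg1 n lam (on_vertical c y) kl) > 0" if "kl \<in> pairs n" for kl y
    using assms(3) that by (cases kl) (simp add: Re_gamma_arg1_on_vertical)
  have pos2: "linear_map (pairs n) shift_coeff c ij > 0" if "ij \<in> pairs n" for ij
    using assms(4) that by (cases ij) (simp add: linear_map_shift_coeff)
  interpret finite_product_sigma_finite "\<lambda>_::nat \<times> nat. lborel :: real measure" "pairs n"
    by standard simp
  interpret pair: pair_sigma_finite ?M ?M
    by (intro pair_sigma_finite.intro sigma_finite_measure_axioms)
  have w_int: "has_bochner_integral ?M (\<lambda>w. F w y) (MB y)" for y
    unfolding F_def MB_def using has_bochner_integral_joint_kernel_w[OF n pos1] .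
  have y_int: "has_bochner_integral ?M (\<lambda>y. F w y) (complex_of_real ((2 * pi) ^ d) * wave_kernel n lam x w)" for w
    unfolding F_def d[symmetric] using has_bochner_integral_joint_kernel_y[OF pos2] .
  have F_int: "integrable (?M \<Otimes>\<^sub>M ?M) (\<lambda>(w, y). F w y)"
  proof -
    define P where "P y = (\<Prod>ij\<in>pairs n. Gamma (gamma_arg2 n (on_vertical c y) ij) *
      exp (- (gamma_arg2 n (on_vertical c y) ij * complex_of_real (root_diff n x ij))))" for y
    define Q where "Q w y = (\<Prod>kl\<in>pairs n. exp (gamma_arg1 n lam (on_vertical c y) kl *
      complex_of_real (linear_map (pairs n) dual_coeff w kl) -
       complex_of_real (exp (linear_map (pairs n) dual_coeff w kl))))" for w y
    have F_eq: "F w y = P y * Q w y" for w y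
      by (simp add: F_def P_def Q_def joint_kernel_def)
    have P: "integrable ?M P"
      using has_bochner_integral_mellin_barnes_shift[OF pos2, of "root_diff n x"]
      by (auto simp: P_def[abs_def] has_bochner_integral_iff)
    then have [measurable]: "P \<in> borel_measurable ?M" by simp
    have Q: "integrable ?M (\<lambda>w. Q w (\<lambda>_. 0))"
      using has_bochner_integral_dual_exp[of n "gamma_arg1 n lam (on_vertical c (\<lambda>_. 0))", OF pos1]
      by (auto simp: Q_def has_bochner_integral_iff)
    \<comment> \<open>The modulus of each exponential depends only on Re \<open>gamma_arg1\<close>,
      which is constant on the vertical plane; y = 0 is a representative.\<close>
    have norm_Q: "norm (Q w y) = norm (Q w (\<lambda>_. 0))" for w y
      unfolding Q_def prod_norm[symmetric]
    proof (rule prod.cong[OF refl])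
      fix kl assume "kl \<in> pairs n"
      have "Re (gamma_arg1 n lam (on_vertical c y) kl) = Re (gamma_arg1 n lam (on_vertical c (\<lambda>_. 0)) kl)"
        by (cases kl) (simp only: Re_gamma_arg1_on_vertical)
      then show "norm (exp (gamma_arg1 n lam (on_vertical c y) kl * complex_of_real (linear_map (pairs n) dual_coeff w kl) -
          complex_of_real (exp (linear_map (pairs n) dual_coeff w kl)))) =
        norm (exp (gamma_arg1 n lam (on_vertical c (\<lambda>_. 0)) kl * complex_of_real (linear_map (pairs n) dual_coeff w kl) -
          complex_of_real (exp (linear_map (pairs n) dual_coeff w kl))))"
        by simp
    qed
    show ?thesis
    proof (rule integrable_pair_bound)
      show "(\<lambda>(w, y). F w y) \<in> borel_measurable (?M \<Otimes>\<^sub>M ?M)"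
        unfolding F_eq Q_def by measurable
      show "integrable ?M (\<lambda>w. norm (Q w (\<lambda>_. 0)))" using Q by simp
      show "integrable ?M (\<lambda>y. norm (P y))" using P by simp
      show "norm (case (w, y) of (w, y) \<Rightarrow> F w y) \<le> norm (Q w (\<lambda>_. 0)) * norm (P y)" for w y
        by (simp add: F_eq norm_mult norm_Q[of w y])
    qed (rule sigma_finite_measure_axioms)+
  qed
  \<comment> \<open>The inner integral over \<open>w\<close> is the Mellin-Barnes integrand and the
    one over \<open>y\<close> is the wave kernel, so Fubini compares the two sides of the
    theorem.\<close>
  have MB_eq: "MB y = (LINT w|?M. F w y)" for y
    using w_int by (simp add: has_bochner_integral_iff)
  have K_eq: "wave_kernel n lam x w = (LINT y|?M. F w y) / complex_of_real ((2 * pi) ^ d)" for w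
    using y_int by (simp add: has_bochner_integral_iff)
  have MB_int: "integrable ?M MB"
    unfolding MB_eq[abs_def] by (rule pair.integrable_snd[OF F_int])
  have "integrable ?M (\<lambda>w. LINT y|?M. F w y)"
    by (rule pair.integrable_fst[OF F_int])
  then have K: "has_bochner_integral ?M (wave_kernel n lam x) ((LINT y|?M. MB y) / complex_of_real ((2 * pi) ^ d))"
    unfolding K_eq[abs_def] MB_eq using pair.Fubini_integral[OF F_int]
    by (simp add: has_bochner_integral_iff)
  let ?R = "complex_of_real (exp (- (\<Sum>k = 1..n. rho n k * x k)))"
  let ?L = "exp (- \<i> * complex_of_real (\<Sum>k = 1..n. lam k * x k))"
  have "has_bochner_integral ?M (\<lambda>t. ?L * ((\<Prod>ij\<in>pairs n. indicator {0<..} (t ij) / t ij) *\<^sub>R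
      wave_kernel n lam x (\<lambda>ij\<in>pairs n. ln (t ij)))) (?L * ((LINT y|?M. MB y) / complex_of_real ((2 * pi) ^ d)))"
    by (intro has_bochner_integral_mult_right has_bochner_integral_log_coordinates[OF finite_pairs K])
  also have "?this \<longleftrightarrow> has_bochner_integral ?M (\<lambda>t. ?R * (indicator (pos_params n) t *\<^sub>R wave_integrand n lam x t))
      (?L * ((LINT y|?M. MB y) / complex_of_real ((2 * pi) ^ d)))"
  proof (rule has_bochner_integral_cong[OF refl _ refl])
    fix t assume "t \<in> space ?M"
    then have ext: "t \<in> extensional (pairs n)" by (simp add: space_PiM PiE_def)
    show "?L * ((\<Prod>ij\<in>pairs n. indicator {0<..} (t ij) / t ij) *\<^sub>R
        wave_kernel n lam x (\<lambda>ij\<in>pairs n. ln (t ij))) =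
      ?R * (indicator (pos_params n) t *\<^sub>R wave_integrand n lam x t)"
    proof (cases "t \<in> pos_params n")
      case True
      have prod: "(\<Prod>ij\<in>pairs n. indicator {0<..} (t ij) / t ij) = (\<Prod>ij\<in>pairs n. 1 / t ij)"
        using pos_params_pos[OF True] by (intro prod.cong) auto
      have ind: "indicator (pos_params n) t = (1 :: real)" using True by simp
      have eq: "?R * wave_integrand n lam x t = ?L * (complex_of_real (\<Prod>ij\<in>pairs n. 1 / t ij) *
          wave_kernel n lam x (\<lambda>ij\<in>pairs n. ln (t ij)))"
        by (rule wave_integrand_eq[OF True]) simp
      show ?thesis
        unfolding ind prod scaleR_one eq by (simp only: scaleR_conv_of_real)
    next
      case False
      then obtain ij where "ij \<in> pairs n" "\<not> t ij > 0"
        using ext by (auto simp: pos_params_def PiE_def)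
      then have "(\<Prod>ij\<in>pairs n. indicator {0<..} (t ij) / t ij) = 0"
        \<comment> \<open>Points of the product space outside \<open>pos_params n\<close> have a
          nonpositive coordinate, since they are extensional.\<close>
        by (intro prod_zero finite_pairs bexI[of _ ij]) simp_all
      then show ?thesis using False by simp
    qed
  qed
  finally have W: "has_bochner_integral ?M (\<lambda>t. ?R * (indicator (pos_params n) t *\<^sub>R wave_integrand n lam x t))
      (?L * ((LINT y|?M. MB y) / complex_of_real ((2 * pi) ^ d)))" .
  have R: "?R \<noteq> 0" unfolding of_real_eq_0_iff by (rule exp_not_eq_zero)
  have "set_integrable ?M (pos_params n) (wave_integrand n lam x)"
  proof -
    have "integrable ?M (\<lambda>t. inverse ?R * (?R * (indicator (pos_params n) t *\<^sub>R wave_integrand n lam x t)))"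
      by (intro integrable_mult_right integrable.intros[OF W])
    then show ?thesis
      by (simp only: set_integrable_def mult.assoc[symmetric] left_inverse[OF R] mult_1)
  qed
  moreover have "vertical_integrable (pairs n) c (mellin_barnes_integrand n lam x)"
    using MB_int by (simp add: vertical_integrable_def MB_def[abs_def])
  moreover have "wave_function n lam x = ?L / (2 * complex_of_real pi * \<i>) ^ d *
      vertical_integral (pairs n) c (mellin_barnes_integrand n lam x)"
  proof -
    have "wave_function n lam x = ?R * (LINT t|?M. indicator (pos_params n) t *\<^sub>R wave_integrand n lam x t)"
      by (simp only: wave_function_def set_lebesgue_integral_def)
    also have "\<dots> = (LINT t|?M. ?R * (indicator (pos_params n) t *\<^sub>R wave_integrand n lam x t))"
      by (rule integral_mult_right_zero[symmetric])
    also have "\<dots> = ?L * ((LINT y|?M. MB y) / complex_of_real ((2 * pi) ^ d))"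
      using W by (rule has_bochner_integral_integral_eq)
    \<comment> \<open>The inversion yields only (2 pi)^d; the power of i in the denominator is
      matched by the one in \<open>vertical_integral\<close>.\<close>
    also have "\<dots> = ?L / (2 * complex_of_real pi * \<i>) ^ d * (\<i> ^ d * (LINT y|?M. MB y))"
    proof -
      have "a * (b / complex_of_real ((2 * pi) ^ d)) = a / (2 * complex_of_real pi * \<i>) ^ d * (\<i> ^ d * b)" for a b
        by (simp add: power_mult_distrib)
      then show ?thesis .
    qed
    finally show ?thesis
      by (simp only: vertical_integral_def d MB_def)
  qed
  ultimately show ?thesis by blast
qed

end
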